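(* Let $(\Omega,\mathscr F,\mathbb P)=(\mathcal A^{\mathbb N},\mathcal F^{\mathbb N},p^{\mathbb N})$ with $\mathcal A$ a finite alphabet and $\tau$ the Bernoulli shift, and let $a:\Omega\to(0,\infty)$ be a function such that $\phi(\omega)=\log a(\omega)$ is Hölder continuous, $$\int\log a(\omega)\,d\mathbb P=0,\qquad a(\omega)\neq1\ \text{ for every }\omega\in\Omega,$$ and the equation $\phi=u\circ\tau-u$ has no solution $u\in L^2(\mathbb P)$. Consider the skew product $$F_a:\Omega\times I\to\Omega\times I,\qquad F_a(\omega,x)=(\tau(\omega),f_\omega(x)),\quad f_\omega(x)=\frac{a(\omega)x}{1+(a(\omega)-1)x}.$$ Then $F_a$ exhibits historical behavior for $(\mathbb P\times\mathrm{Leb})$-a.e. point. Moreover, $$\mathcal L(\omega,x)=\{\lambda\delta_0+(1-\lambda)\delta_1:\lambda\in[0,1]\}\quad\text{for }(\mathbb P\times\mathrm{Leb})\text{-a.e. }(\omega,x)\in\Omega\times I.$$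
   Context: $I=[0,1]$ with Lebesgue measure $\mathrm{Leb}$. $\mathcal F$ is the discrete $\sigma$-algebra of $\mathcal A$ and $p$ is a probability measure on $\mathcal A$ with full support. $f^0_\omega=\mathrm{id}$ and $f^n_\omega=f_{\tau^{n-1}(\omega)}\circ\dots\circ f_\omega$ for $n\ge1$. Hölder continuity is with respect to the usual metric on the shift space $\mathcal A^{\mathbb N}$. Historical behavior for $(\mathbb P\times\mathrm{Leb})$-a.e. point: for $(\mathbb P\times\mathrm{Leb})$-a.e. $(\omega,x)$ there is a continuous $\varphi:I\to\mathbb R$ such that $\lim_{n\to\infty}\frac1n\sum_{j=0}^{n-1}\varphi(f^j_\omega(x))$ does not exist. $\mathcal L(\omega,x)$ is the set of weak$^*$ accumulation points of $\frac1n\sum_{j=0}^{n-1}\delta_{f^j_\omega(x)}$, $n\ge1$. *)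

theory Defs
  imports "HOL-Probability.Probability"
begin

section \<open>The one-sided Bernoulli shift\<close>

text \<open>The alphabet is a finite type \<open>'a\<close>.  A probability measure on its discrete \<open>\<sigma>\<close>-algebra is a
  probability mass function \<open>p\<close>; full support is \<open>set_pmf p = UNIV\<close>.\<close>

definition bernoulli :: "'a pmf \<Rightarrow> (nat \<Rightarrow> 'a) measure" where
  "bernoulli p = Pi\<^sub>M UNIV (\<lambda>_. measure_pmf p)"

definition left_shift :: "(nat \<Rightarrow> 'a) \<Rightarrow> (nat \<Rightarrow> 'a)" where
  "left_shift \<omega> = (\<lambda>n. \<omega> (Suc n))"

text \<open>The usual metric on the shift space.  Replacing the base \<open>1/2\<close> by another number in \<open>(0,1)\<close>
  changes Hoelder exponents but not the class of Hoelder continuous functions.\<close>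

definition shift_dist :: "(nat \<Rightarrow> 'a) \<Rightarrow> (nat \<Rightarrow> 'a) \<Rightarrow> real" where
  "shift_dist \<omega> \<omega>' = (if \<omega> = \<omega>' then 0 else (1/2) ^ (LEAST n. \<omega> n \<noteq> \<omega>' n))"

definition hoelder_continuous :: "((nat \<Rightarrow> 'a) \<Rightarrow> real) \<Rightarrow> bool" where
  "hoelder_continuous \<phi> \<longleftrightarrow>
     (\<exists>C \<alpha>. 0 < \<alpha> \<and> (\<forall>\<omega> \<omega>'. \<bar>\<phi> \<omega> - \<phi> \<omega>'\<bar> \<le> C * shift_dist \<omega> \<omega>' powr \<alpha>))"

definition L2_coboundary :: "(nat \<Rightarrow> 'a) measure \<Rightarrow> ((nat \<Rightarrow> 'a) \<Rightarrow> real) \<Rightarrow> bool" where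
  "L2_coboundary P \<phi> \<longleftrightarrow>
     (\<exists>u \<in> borel_measurable P. integrable P (\<lambda>\<omega>. (u \<omega>)\<^sup>2) \<and>
        (AE \<omega> in P. \<phi> \<omega> = u (left_shift \<omega>) - u \<omega>))"


section \<open>Skew products over the shift with fibre \<open>[0,1]\<close>\<close>

text \<open>The fibre \<open>I = [0,1]\<close> is the carrier of the measures below; points of \<open>I\<close> are represented as
  real numbers.\<close>

definition borel_I :: "real measure" where
  "borel_I = restrict_space borel {0..1}"

definition Leb_I :: "real measure" where
  "Leb_I = restrict_space lborel {0..1}"

definition skew_product ::
  "((nat \<Rightarrow> 'a) \<Rightarrow> real \<Rightarrow> real) \<Rightarrow> (nat \<Rightarrow> 'a) \<times> real \<Rightarrow> (nat \<Rightarrow> 'a) \<times> real" where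
  "skew_product f = (\<lambda>(\<omega>, x). (left_shift \<omega>, f \<omega> x))"

definition fibre_map ::
  "((nat \<Rightarrow> 'a) \<times> real \<Rightarrow> (nat \<Rightarrow> 'a) \<times> real) \<Rightarrow> (nat \<Rightarrow> 'a) \<Rightarrow> real \<Rightarrow> real" where
  "fibre_map F \<omega> x = snd (F (\<omega>, x))"

fun fibre_iterate ::
  "((nat \<Rightarrow> 'a) \<times> real \<Rightarrow> (nat \<Rightarrow> 'a) \<times> real) \<Rightarrow> nat \<Rightarrow> (nat \<Rightarrow> 'a) \<Rightarrow> real \<Rightarrow> real" where
  "fibre_iterate F 0 \<omega> = id"
| "fibre_iterate F (Suc n) \<omega> = fibre_map F ((left_shift ^^ n) \<omega>) \<circ> fibre_iterate F n \<omega>"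

lemma fibre_map_skew_product [simp]: "fibre_map (skew_product f) = f"
  by (intro ext) (simp add: fibre_map_def skew_product_def)

lemma skew_product_funpow:
  "(skew_product f ^^ n) (\<omega>, x) = ((left_shift ^^ n) \<omega>, fibre_iterate (skew_product f) n \<omega> x)"
  by (induction n) (simp_all add: skew_product_def fibre_map_def)

definition historical_behavior ::
  "(nat \<Rightarrow> 'a) measure \<Rightarrow> ((nat \<Rightarrow> 'a) \<times> real \<Rightarrow> (nat \<Rightarrow> 'a) \<times> real) \<Rightarrow> bool" where
  "historical_behavior P F \<longleftrightarrow>
     (AE (\<omega>, x) in P \<Otimes>\<^sub>M Leb_I. \<exists>\<phi> :: real \<Rightarrow> real. continuous_on {0..1} \<phi> \<and>
        \<not> convergent (\<lambda>n. (1 / real n) * (\<Sum>j<n. \<phi> (fibre_iterate F j \<omega> x))))"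


section \<open>Weak* accumulation points of empirical measures\<close>

lemma space_borel_I [simp]: "space borel_I = {0..1}"
  by (simp add: borel_I_def space_restrict_space)

text \<open>The weak* topology on the Borel probability measures on \<open>I\<close>: the coarsest topology making
  \<open>\<mu> \<mapsto> \<integral>\<phi> d\<mu>\<close> continuous for every continuous \<open>\<phi>\<close> on \<open>I\<close>.\<close>

definition weak_star_topology :: "real measure topology" where
  "weak_star_topology =
     pullback_topology (space (prob_algebra borel_I))
       (\<lambda>\<mu>. \<lambda>\<phi>\<in>{\<phi>. continuous_on {0..1} \<phi>}. \<integral>x. \<phi> x \<partial>\<mu>)
       (product_topology (\<lambda>_. euclideanreal) {\<phi> :: real \<Rightarrow> real. continuous_on {0..1} \<phi>})"

lemma topspace_weak_star_topology:
  "topspace weak_star_topology = {\<mu>. sets \<mu> = sets borel_I \<and> prob_space \<mu>}"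
  by (auto simp: weak_star_topology_def topspace_pullback_topology space_prob_algebra)

lemma limitin_weak_star_topology:
  assumes "\<And>n. M n \<in> topspace weak_star_topology" "\<mu> \<in> topspace weak_star_topology"
  shows "limitin weak_star_topology M \<mu> F \<longleftrightarrow>
    (\<forall>\<phi> :: real \<Rightarrow> real. continuous_on {0..1} \<phi> \<longrightarrow> ((\<lambda>n. \<integral>x. \<phi> x \<partial>M n) \<longlongrightarrow> (\<integral>x. \<phi> x \<partial>\<mu>)) F)"
proof -
  define C where "C = {\<phi> :: real \<Rightarrow> real. continuous_on {0..1} \<phi>}"
  define I where "I = (\<lambda>\<mu>. \<lambda>\<phi>\<in>C. \<integral>x. \<phi> x \<partial>\<mu> :: real)"
  define T where "T = product_topology (\<lambda>_. euclideanreal) C"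
  define A where "A = space (prob_algebra borel_I)"
  have W: "weak_star_topology = pullback_topology A I T"
    by (simp add: weak_star_topology_def C_def I_def T_def A_def)
  have A: "topspace weak_star_topology = A"
    by (simp add: topspace_weak_star_topology A_def space_prob_algebra)
  have top: "I \<nu> \<in> topspace T" for \<nu>
    by (simp add: I_def T_def)
  have "limitin weak_star_topology M \<mu> F \<longleftrightarrow> limitin T (\<lambda>n. I (M n)) (I \<mu>) F"
  proof -
    have "limitin weak_star_topology M \<mu> F \<longleftrightarrow>
        (\<forall>V. openin T V \<and> \<mu> \<in> I -` V \<inter> A \<longrightarrow> (\<forall>\<^sub>F n in F. M n \<in> I -` V \<inter> A))"
      using assms(2) unfolding limitin_def W openin_pullback_topology by blast
    also have "\<dots> \<longleftrightarrow> limitin T (\<lambda>n. I (M n)) (I \<mu>) F"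
      using assms A top by (simp add: limitin_def)
    finally show ?thesis .
  qed
  also have "\<dots> \<longleftrightarrow> (\<forall>\<phi>\<in>C. ((\<lambda>n. \<integral>x. \<phi> x \<partial>M n) \<longlongrightarrow> (\<integral>x. \<phi> x \<partial>\<mu>)) F)"
    using top by (simp add: T_def limitin_componentwise) (simp add: I_def)
  finally show ?thesis by (simp add: C_def)
qed

definition weak_star_accumulation_points :: "(nat \<Rightarrow> real measure) \<Rightarrow> real measure set" where
  "weak_star_accumulation_points M =
     {\<mu> \<in> topspace weak_star_topology.
        \<forall>U. openin weak_star_topology U \<and> \<mu> \<in> U \<longrightarrow> (\<exists>\<^sub>\<infinity>n. M n \<in> U)}"

definition empirical_measure :: "(nat \<Rightarrow> real) \<Rightarrow> nat \<Rightarrow> real measure" where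
  "empirical_measure y n =
     measure_of (space borel_I) (sets borel_I)
       (\<lambda>A. ennreal (1 / real n) * (\<Sum>j<n. emeasure (return borel_I (y j)) A))"

definition dirac_mixture :: "real \<Rightarrow> real measure" where
  "dirac_mixture t =
     measure_of (space borel_I) (sets borel_I)
       (\<lambda>A. ennreal t * emeasure (return borel_I 0) A
          + ennreal (1 - t) * emeasure (return borel_I 1) A)"

text \<open>The set functions above are measures, so \<open>measure_of\<close> does not fall back to the null
  measure.\<close>

lemma sets_empirical_measure [simp]: "sets (empirical_measure y n) = sets borel_I"
  by (simp add: empirical_measure_def del: space_borel_I)

lemma sets_dirac_mixture [simp]: "sets (dirac_mixture l) = sets borel_I"
  by (simp add: dirac_mixture_def del: space_borel_I)

lemma emeasure_empirical_measure:
  assumes "A \<in> sets borel_I"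
  shows "emeasure (empirical_measure y n) A =
    ennreal (1 / real n) * (\<Sum>j<n. emeasure (return borel_I (y j)) A)"
proof (rule emeasure_measure_of[OF empirical_measure_def])
  show "countably_additive (sets (empirical_measure y n))
      (\<lambda>A. ennreal (1 / real n) * (\<Sum>j<n. emeasure (return borel_I (y j)) A))"
  proof (rule countably_additiveI)
    fix B :: "nat \<Rightarrow> real set"
    assume B: "range B \<subseteq> sets (empirical_measure y n)" "disjoint_family B"
    have "(\<Sum>i. ennreal (1 / real n) * (\<Sum>j<n. emeasure (return borel_I (y j)) (B i)))
        = ennreal (1 / real n) * (\<Sum>j<n. \<Sum>i. emeasure (return borel_I (y j)) (B i))"
      by (simp add: suminf_sum)
    also have "\<dots> = ennreal (1 / real n) * (\<Sum>j<n. emeasure (return borel_I (y j)) (\<Union>i. B i))"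
      using B by (intro arg_cong2[where f = "(*)"] sum.cong refl suminf_emeasure) auto
    finally show "(\<Sum>i. ennreal (1 / real n) * (\<Sum>j<n. emeasure (return borel_I (y j)) (B i)))
        = ennreal (1 / real n) * (\<Sum>j<n. emeasure (return borel_I (y j)) (\<Union>i. B i))" .
  qed
qed (use assms sets.space_closed[of borel_I] in \<open>auto simp: positive_def\<close>)

lemma emeasure_dirac_mixture:
  assumes "A \<in> sets borel_I"
  shows "emeasure (dirac_mixture l) A =
    ennreal l * emeasure (return borel_I 0) A + ennreal (1 - l) * emeasure (return borel_I 1) A"
proof (rule emeasure_measure_of[OF dirac_mixture_def])
  show "countably_additive (sets (dirac_mixture l))
      (\<lambda>A. ennreal l * emeasure (return borel_I 0) A + ennreal (1 - l) * emeasure (return borel_I 1) A)"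
  proof (rule countably_additiveI)
    fix B :: "nat \<Rightarrow> real set"
    assume B: "range B \<subseteq> sets (dirac_mixture l)" "disjoint_family B"
    have E: "(\<Sum>i. emeasure (return borel_I z) (B i)) = emeasure (return borel_I z) (\<Union>i. B i)" for z
      using B by (intro suminf_emeasure) auto
    show "(\<Sum>i. ennreal l * emeasure (return borel_I 0) (B i)
            + ennreal (1 - l) * emeasure (return borel_I 1) (B i))
        = ennreal l * emeasure (return borel_I 0) (\<Union>i. B i)
            + ennreal (1 - l) * emeasure (return borel_I 1) (\<Union>i. B i)"
      by (simp add: suminf_add[symmetric] E del: emeasure_return)
  qed
qed (use assms sets.space_closed[of borel_I] in \<open>auto simp: positive_def\<close>)

text \<open>The set \<open>\<L>(\<omega>, x)\<close>.  The index \<open>n = 0\<close> of the sequence is irrelevant for accumulation points.\<close>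

definition limit_measures ::
  "((nat \<Rightarrow> 'a) \<times> real \<Rightarrow> (nat \<Rightarrow> 'a) \<times> real) \<Rightarrow> (nat \<Rightarrow> 'a) \<Rightarrow> real \<Rightarrow> real measure set" where
  "limit_measures F \<omega> x =
     weak_star_accumulation_points (empirical_measure (\<lambda>j. fibre_iterate F j \<omega> x))"


section \<open>The skew product \<open>F\<^sub>a\<close>\<close>

definition F_skew ::
  "((nat \<Rightarrow> 'a) \<Rightarrow> real) \<Rightarrow> (nat \<Rightarrow> 'a) \<times> real \<Rightarrow> (nat \<Rightarrow> 'a) \<times> real" where
  "F_skew a = skew_product (\<lambda>\<omega> x. a \<omega> * x / (1 + (a \<omega> - 1) * x))"

lemma F_skew_fibre_invariant:
  assumes "a \<omega> > 0" "x \<in> {0..1}"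
  shows "fibre_map (F_skew a) \<omega> x \<in> {0..1}"
proof -
  have "0 \<le> a \<omega> * x" "0 \<le> 1 - x" "0 < a \<omega> * x + (1 - x)"
    using assms by (auto simp: add_pos_nonneg) (cases "x = 0"; simp add: add_pos_nonneg)
  then have "a \<omega> * x / (a \<omega> * x + (1 - x)) \<in> {0..1}" by (simp add: divide_simps)
  then show ?thesis by (simp add: F_skew_def algebra_simps)
qed

end

theory Submission
  imports Defs "HOL-Real_Asymp.Real_Asymp"
begin

text \<open>
  In the logit coordinate \<open>z = ln (x / (1 - x))\<close> the fibre maps are translations: the
  orbit of an inner point \<open>x\<close> is \<open>z + S\<^sub>n\<close> with the Birkhoff sums
  \<open>S\<^sub>n = \<phi> + \<phi> \<circ> \<tau> + \<dots> + \<phi> \<circ>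
  \<tau>\<^bsup>n-1\<^esup>\<close> of \<open>\<phi> = ln a\<close>. So the theorem is about a
  random walk on the line with weakly dependent increments of mean zero, and large positive and
  negative heights stand for the neighbourhoods of the end points \<open>1\<close> and
  \<open>0\<close>. For almost every \<open>\<omega>\<close>, two things are shown:

  \<^item> the walk spends a fraction of time tending to zero in every bounded set
    (\<open>AE_bounded_density_zero\<close>), so that all accumulation points are mixtures of the
    two Dirac measures;
  \<^item> for every \<open>\<epsilon> > 0\<close> there are arbitrarily large times up to which the walk was
    above a given level for a fraction \<open>1 - \<epsilon>\<close> of the time, and likewise
    below (\<open>AE_high_fraction\<close>). As the fraction of time spent below \<open>0\<close>
    changes slowly, it accumulates at every number in \<open>[0, 1]\<close>
    (\<open>low_fraction_approximates\<close>), which gives all mixtures and the divergence of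
    time averages.

  Both facts are insensitive to bounded perturbations of the walk. Gordin's method
  (\<open>gordin_decomposition\<close>) therefore replaces \<open>\<phi>\<close> by a function
  \<open>\<psi>\<close> that differs from it by a bounded coboundary and is annihilated by the
  transfer operator, which makes the Birkhoff sums a martingale when read backwards in time. The
  hypothesis that \<open>\<phi>\<close> is not a coboundary says that this martingale has positive
  variance.

  The first fact follows from a convexity argument (\<open>occupation_probability_sum\<close>): the
  expectation of a convex function that is quadratic on \<open>[-M, M]\<close> and linear outside
  grows at each block of steps in proportion to the probability of being in \<open>[-M,
  M]\<close>, but is only of order \<open>sqrt n\<close> at time \<open>n\<close>. The same
  estimate, with \<open>M\<close> of order \<open>sqrt n\<close>, takes the place of the central
  limit theorem: it shows that fluctuations of order \<open>sqrt n\<close> have probability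
  bounded below (\<open>upward_fluctuation\<close>). For the second fact, several such
  fluctuations in a row lift the walk so high that it stays up for most of a much longer period;
  this has a probability bounded below (\<open>high_fraction_probability\<close>), and independent
  attempts at it succeed eventually (\<open>AE_shifted_hit\<close>). Independence comes from the
  fact that, by Hoelder continuity, a Birkhoff sum of length \<open>n\<close> depends on the
  coordinates after the \<open>n\<close>-th only up to a bounded error
  (\<open>birkhoff_near\<close>).
\<close>

section \<open>Bernoulli measures and the shift\<close>

lemma space_bernoulli [simp]: "space (bernoulli p) = UNIV"
  by (simp add: bernoulli_def space_PiM)

lemma prob_space_bernoulli: "prob_space (bernoulli p)"
  unfolding bernoulli_def by (intro prob_space_PiM measure_pmf.prob_space_axioms)

interpretation B: prob_space "bernoulli p" for p
  by (rule prob_space_bernoulli)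

lemma measure_bernoulli_UNIV [simp]: "measure (bernoulli p) UNIV = 1"
  using B.prob_space[of p] by simp

lemma sequence_space_pmf: "sequence_space (measure_pmf p)"
  by unfold_locales

lemma measurable_comb_seq_bernoulli [measurable (raw)]:
  "f \<in> N \<rightarrow>\<^sub>M bernoulli p \<Longrightarrow> g \<in> N \<rightarrow>\<^sub>M bernoulli p \<Longrightarrow> (\<lambda>x. comb_seq n (f x) (g x)) \<in> N \<rightarrow>\<^sub>M bernoulli p"
  unfolding bernoulli_def by (rule measurable_comb_seq')

lemma measurable_coordinate [measurable]: "(\<lambda>\<omega>. \<omega> n) \<in> bernoulli p \<rightarrow>\<^sub>M count_space UNIV"
proof -
  have "(\<lambda>\<omega>. \<omega> n) \<in> bernoulli p \<rightarrow>\<^sub>M measure_pmf p"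
    unfolding bernoulli_def by (rule measurable_component_singleton) simp
  then show ?thesis by simp
qed

lemma measurable_left_shift [measurable]: "left_shift \<in> bernoulli p \<rightarrow>\<^sub>M bernoulli p"
proof -
  have "(\<lambda>\<omega>. left_shift \<omega>) \<in> bernoulli p \<rightarrow>\<^sub>M PiM UNIV (\<lambda>_. measure_pmf p)"
    unfolding left_shift_def by (rule measurable_PiM_single') (auto simp: space_PiM)
  then show ?thesis by (simp add: bernoulli_def)
qed

lemma measurable_left_shift_funpow [measurable]:
  "left_shift ^^ n \<in> bernoulli p \<rightarrow>\<^sub>M bernoulli p"
proof (induction n)
  case (Suc n)
  then show ?case using measurable_comp[OF Suc measurable_left_shift] by simp
qed (simp add: id_def)

lemma left_shift_funpow: "(left_shift ^^ n) \<omega> = (\<lambda>i. \<omega> (i + n))"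
  by (induction n arbitrary: \<omega>) (auto simp: left_shift_def)

lemma left_shift_comb_seq [simp]: "(left_shift ^^ n) (comb_seq n \<omega> \<omega>') = \<omega>'"
  by (simp add: left_shift_funpow comb_seq_def)

lemma comb_seq_comb_seq:
  "comb_seq (n + m) (comb_seq n \<omega> \<omega>') \<omega>'' = comb_seq n \<omega> (comb_seq m \<omega>' \<omega>'')"
  by (auto simp: comb_seq_def fun_eq_iff)

text \<open>A \<open>p\<close>-random sequence is a \<open>p\<close>-random initial block followed by an
  independent \<open>p\<close>-random tail. All uses of independence and of the shift invariance
  of the Bernoulli measure below go through this Fubini formula.\<close>

lemma integral_split:
  fixes f :: "(nat \<Rightarrow> 'a) \<Rightarrow> real"
  assumes [measurable]: "f \<in> borel_measurable (bernoulli p)" and b: "\<And>\<omega>. \<bar>f \<omega>\<bar> \<le> K"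
  shows "(\<integral>\<omega>. f \<omega> \<partial>bernoulli p) = (\<integral>\<omega>'. (\<integral>\<omega>. f (comb_seq n \<omega> \<omega>') \<partial>bernoulli p) \<partial>bernoulli p)"
proof -
  let ?P = "bernoulli p"
  interpret PP: pair_prob_space ?P ?P ..
  interpret sequence_space "measure_pmf p" by (rule sequence_space_pmf)
  have D: "distr (?P \<Otimes>\<^sub>M ?P) ?P (\<lambda>(\<omega>, \<omega>'). comb_seq n \<omega> \<omega>') = ?P"
    using PiM_comb_seq[of n] by (simp add: bernoulli_def)
  have "(\<integral>\<omega>. f \<omega> \<partial>?P) = (\<integral>\<omega>. f \<omega> \<partial>(distr (?P \<Otimes>\<^sub>M ?P) ?P (\<lambda>(\<omega>, \<omega>'). comb_seq n \<omega> \<omega>')))"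
    by (simp only: D)
  also have "\<dots> = (\<integral>z. f (comb_seq n (fst z) (snd z)) \<partial>(?P \<Otimes>\<^sub>M ?P))"
    by (subst integral_distr) (auto simp: case_prod_beta)
  also have "\<dots> = (\<integral>z. (\<lambda>(\<omega>, \<omega>'). f (comb_seq n \<omega> \<omega>')) z \<partial>(?P \<Otimes>\<^sub>M ?P))"
    by (simp add: case_prod_beta)
  also have "\<dots> = (\<integral>\<omega>'. (\<integral>\<omega>. f (comb_seq n \<omega> \<omega>') \<partial>?P) \<partial>?P)"
    by (rule PP.integral_snd[symmetric], rule PP.P.integrable_const_bound[where B=K])
       (auto simp: b)
  finally show ?thesis .
qed

lemma integrable_bounded:
  fixes f :: "(nat \<Rightarrow> 'a) \<Rightarrow> real"
  assumes "f \<in> borel_measurable (bernoulli p)" and "\<And>\<omega>. \<bar>f \<omega>\<bar> \<le> K"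
  shows "integrable (bernoulli p) f"
  by (rule B.integrable_const_bound[where B=K]) (auto simp: assms)

lemma abs_integral_le:
  fixes f :: "(nat \<Rightarrow> 'a) \<Rightarrow> real"
  assumes "\<And>\<omega>. \<bar>f \<omega>\<bar> \<le> K" 
  shows "\<bar>\<integral>\<omega>. f \<omega> \<partial>bernoulli p\<bar> \<le> K"
proof (cases "integrable (bernoulli p) f")
  case True
  have "\<bar>\<integral>\<omega>. f \<omega> \<partial>bernoulli p\<bar> \<le> (\<integral>\<omega>. \<bar>f \<omega>\<bar> \<partial>bernoulli p)" by (rule integral_abs_bound)
  also have "\<dots> \<le> (\<integral>\<omega>. K \<partial>bernoulli p)" using True assms by (intro integral_mono) auto
  finally show ?thesis by simp
next
  case False
  then show ?thesis using order_trans[OF abs_ge_zero assms] by (simp add: not_integrable_integral_eq)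
qed

section \<open>Hoelder functions and the transfer operator\<close>

text \<open>Hoelder continuity in the form in which it is used: changing the coordinates from \<open>n\<close>
  on changes the value by an exponentially small amount.\<close>

definition cylinder_lipschitz :: "real \<Rightarrow> real \<Rightarrow> ((nat \<Rightarrow> 'a) \<Rightarrow> real) \<Rightarrow> bool" where
  "cylinder_lipschitz C \<theta> f \<longleftrightarrow> (\<forall>n \<omega> \<omega>'. (\<forall>i<n. \<omega> i = \<omega>' i) \<longrightarrow> \<bar>f \<omega> - f \<omega>'\<bar> \<le> C * \<theta> ^ n)"

lemma cylinder_lipschitzD:
  assumes "cylinder_lipschitz C \<theta> f" and "\<And>i. i < n \<Longrightarrow> \<omega> i = \<omega>' i"
  shows "\<bar>f \<omega> - f \<omega>'\<bar> \<le> C * \<theta> ^ n"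
proof -
  have "\<forall>i<n. \<omega> i = \<omega>' i" using assms(2) by simp
  from assms(1)[unfolded cylinder_lipschitz_def, THEN spec, THEN spec, THEN spec, THEN mp, OF this]
  show ?thesis .
qed

lemma cylinder_lipschitz_osc:
  assumes "cylinder_lipschitz C \<theta> f"
  shows "\<bar>f \<omega> - f \<omega>'\<bar> \<le> C"
proof -
  have "\<bar>f \<omega> - f \<omega>'\<bar> \<le> C * \<theta> ^ 0"
    using assms by (rule cylinder_lipschitzD) simp
  then show ?thesis by simp
qed

lemma cylinder_lipschitz_nonneg: "cylinder_lipschitz C \<theta> f \<Longrightarrow> 0 \<le> C"
  using cylinder_lipschitz_osc[of C \<theta> f undefined undefined] by simp

lemma hoelder_cylinder_lipschitz:
  assumes "hoelder_continuous f"
  obtains C \<theta> where "cylinder_lipschitz C \<theta> f" "0 < \<theta>" "\<theta> < 1"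
proof -
  obtain C \<alpha> where \<alpha>: "0 < \<alpha>" and H: "\<And>\<omega> \<omega>'. \<bar>f \<omega> - f \<omega>'\<bar> \<le> C * shift_dist \<omega> \<omega>' powr \<alpha>"
    using assms unfolding hoelder_continuous_def by blast
  define \<theta> :: real where "\<theta> = (1/2) powr \<alpha>"
  have \<theta>: "0 < \<theta>" "\<theta> < 1" using \<alpha> powr_less_mono2[of \<alpha> "1/2" 1] by (auto simp: \<theta>_def)
  have "\<bar>f \<omega> - f \<omega>'\<bar> \<le> \<bar>C\<bar> * \<theta> ^ n" if "\<forall>i<n. \<omega> i = \<omega>' i" for n \<omega> \<omega>'
  proof -
    have "shift_dist \<omega> \<omega>' powr \<alpha> \<le> \<theta> ^ n"
    proof (cases "\<omega> = \<omega>'")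
      case True
      then show ?thesis using \<theta> by (simp add: shift_dist_def)
    next
      case False
      define l where "l = (LEAST n. \<omega> n \<noteq> \<omega>' n)"
      have "\<omega> l \<noteq> \<omega>' l" unfolding l_def by (rule LeastI_ex) (use False in auto)
      then have "n \<le> l" using that leI by metis
      have "shift_dist \<omega> \<omega>' powr \<alpha> = \<theta> ^ l"
        using False by (simp add: shift_dist_def \<theta>_def flip: l_def powr_realpow)
          (simp add: powr_powr mult.commute)
      also have "\<dots> \<le> \<theta> ^ n" using \<theta> \<open>n \<le> l\<close> by (intro power_decreasing) auto
      finally show ?thesis .
    qed
    then have "\<bar>C\<bar> * shift_dist \<omega> \<omega>' powr \<alpha> \<le> \<bar>C\<bar> * \<theta> ^ n" by (intro mult_left_mono) auto
    moreover have "C * shift_dist \<omega> \<omega>' powr \<alpha> \<le> \<bar>C\<bar> * shift_dist \<omega> \<omega>' powr \<alpha>"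
      by (intro mult_right_mono) auto
    ultimately show ?thesis using H[of \<omega> \<omega>'] by linarith
  qed
  then have "cylinder_lipschitz \<bar>C\<bar> \<theta> f" by (simp add: cylinder_lipschitz_def)
  from that[OF this \<theta>] show ?thesis .
qed

text \<open>Freezing all coordinates from \<open>n\<close> on turns \<open>f\<close> into a function of a word
  of length \<open>n\<close>, which is measurable because there are only countably many words;
  \<open>f\<close> is the pointwise limit of these functions.\<close>

lemma cylinder_lipschitz_measurable:
  fixes f :: "(nat \<Rightarrow> 'a::finite) \<Rightarrow> real"
  assumes f: "cylinder_lipschitz C \<theta> f" and \<theta>: "0 < \<theta>" "\<theta> < 1"
  shows "f \<in> borel_measurable (bernoulli p)"
proof -
  define \<omega>0 :: "nat \<Rightarrow> 'a" where "\<omega>0 = undefined"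
  define g where "g = (\<lambda>n \<omega>. f (comb_seq n \<omega> \<omega>0))"
  have g: "g n \<in> borel_measurable (bernoulli p)" for n
  proof -
    define h where "h = (\<lambda>\<omega>::nat \<Rightarrow> 'a. map \<omega> [0..<n])"
    have "h -` {xs} \<inter> space (bernoulli p) \<in> sets (bernoulli p)" for xs
    proof -
      have "h -` {xs} \<inter> space (bernoulli p) = {\<omega> \<in> space (bernoulli p). length xs = n \<and> (\<forall>i\<in>{..<n}. \<omega> i = xs ! i)}"
        by (auto simp: h_def intro!: nth_equalityI)
      also have "\<dots> \<in> sets (bernoulli p)" by measurable
      finally show ?thesis .
    qed
    then have h: "h \<in> bernoulli p \<rightarrow>\<^sub>M count_space UNIV"
      by (auto simp: measurable_count_space_eq2_countable)
    have "g n \<omega> = f (comb_seq n (\<lambda>i. h \<omega> ! i) \<omega>0)" for \<omega>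
    proof -
      have "comb_seq n \<omega> \<omega>0 = comb_seq n (\<lambda>i. h \<omega> ! i) \<omega>0"
        by (rule ext) (simp add: comb_seq_def h_def)
      then show ?thesis by (simp add: g_def)
    qed
    moreover have "(\<lambda>\<omega>. f (comb_seq n (\<lambda>i. h \<omega> ! i) \<omega>0)) \<in> borel_measurable (bernoulli p)"
      by (rule measurable_compose[OF h]) simp
    ultimately show ?thesis by presburger
  qed
  have lim: "(\<lambda>n. g n \<omega>) \<longlonglongrightarrow> f \<omega>" for \<omega>
  proof (rule LIM_zero_cancel, rule Lim_null_comparison)
    have "\<bar>g n \<omega> - f \<omega>\<bar> \<le> C * \<theta> ^ n" for n
      unfolding g_def by (rule cylinder_lipschitzD[OF f]) (simp add: comb_seq_def)
    then show "\<forall>\<^sub>F n in sequentially. norm (g n \<omega> - f \<omega>) \<le> C * \<theta> ^ n" by simp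
    show "(\<lambda>n. C * \<theta> ^ n) \<longlonglongrightarrow> 0"
      using \<theta> by (intro tendsto_mult_right_zero LIMSEQ_power_zero) auto
  qed
  show ?thesis by (rule borel_measurable_LIMSEQ_real[OF lim g])
qed

text \<open>The \<open>n\<close>-th power of the Ruelle transfer operator of the Bernoulli measure: the
  average of \<open>f\<close> over the preimages of \<open>\<omega>'\<close> under the
  \<open>n\<close>-fold shift. Composed with that shift it is the conditional expectation of
  \<open>f\<close> given the coordinates from \<open>n\<close> on.\<close>

definition transfer :: "'a pmf \<Rightarrow> nat \<Rightarrow> ((nat \<Rightarrow> 'a) \<Rightarrow> real) \<Rightarrow> (nat \<Rightarrow> 'a) \<Rightarrow> real" where
  "transfer p n f \<omega>' = (\<integral>\<omega>. f (comb_seq n \<omega> \<omega>') \<partial>bernoulli p)"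

lemma measurable_transfer [measurable]:
  assumes [measurable]: "f \<in> borel_measurable (bernoulli p)"
  shows "transfer p n f \<in> borel_measurable (bernoulli p)"
  unfolding transfer_def by measurable

lemma transfer_bounded: "(\<And>\<omega>. \<bar>f \<omega>\<bar> \<le> K) \<Longrightarrow> \<bar>transfer p n f \<omega>\<bar> \<le> K"
  unfolding transfer_def by (rule abs_integral_le)

lemma transfer_transfer:
  fixes f :: "(nat \<Rightarrow> 'a) \<Rightarrow> real"
  assumes [measurable]: "f \<in> borel_measurable (bernoulli p)" and b: "\<And>\<omega>. \<bar>f \<omega>\<bar> \<le> K"
  shows "transfer p m (transfer p n f) = transfer p (n + m) f"
proof
  fix \<omega>' :: "nat \<Rightarrow> 'a"
  have "transfer p (n + m) f \<omega>' = (\<integral>\<omega>2. (\<integral>\<omega>1. f (comb_seq (n+m) (comb_seq n \<omega>1 \<omega>2) \<omega>') \<partial>bernoulli p) \<partial>bernoulli p)"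
    unfolding transfer_def by (rule integral_split[where K=K]) (auto simp: b)
  also have "\<dots> = transfer p m (transfer p n f) \<omega>'"
    unfolding transfer_def comb_seq_comb_seq ..
  finally show "transfer p m (transfer p n f) \<omega>' = transfer p (n + m) f \<omega>'" ..
qed

lemma transfer_shift: "transfer p n (\<lambda>\<omega>. f ((left_shift ^^ n) \<omega>)) = f"
  by (simp add: transfer_def fun_eq_iff)

section \<open>Birkhoff sums\<close>

definition birkhoff :: "((nat \<Rightarrow> 'a) \<Rightarrow> real) \<Rightarrow> nat \<Rightarrow> (nat \<Rightarrow> 'a) \<Rightarrow> real" where
  "birkhoff f n \<omega> = (\<Sum>j<n. f ((left_shift ^^ j) \<omega>))"

lemma birkhoff_0 [simp]: "birkhoff f 0 \<omega> = 0"
  by (simp add: birkhoff_def)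

lemma measurable_birkhoff [measurable]:
  assumes [measurable]: "f \<in> borel_measurable (bernoulli p)"
  shows "birkhoff f n \<in> borel_measurable (bernoulli p)"
  unfolding birkhoff_def by measurable

lemma birkhoff_add: "birkhoff f (n + m) \<omega> = birkhoff f n \<omega> + birkhoff f m ((left_shift ^^ n) \<omega>)"
  by (induction m) (simp_all add: birkhoff_def left_shift_funpow add_ac)

lemma birkhoff_bounded: "(\<And>\<omega>. \<bar>f \<omega>\<bar> \<le> K) \<Longrightarrow> \<bar>birkhoff f n \<omega>\<bar> \<le> real n * K"
  unfolding birkhoff_def by (rule order_trans[OF sum_abs]) (rule order_trans[OF sum_bounded_above[where K=K]], auto)

text \<open>Bounded distortion: the \<open>j\<close>-th summand sees the disagreement only from coordinate
  \<open>n - j\<close> on, so the differences sum to at most a geometric series. Up to a bounded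
  error a Birkhoff sum of length \<open>n\<close> is thus a function of the first \<open>n\<close>
  coordinates, hence independent of what happens afterwards.\<close>

lemma birkhoff_near:
  assumes f: "cylinder_lipschitz C \<theta> f" and \<theta>: "0 < \<theta>" "\<theta> < 1" and eq: "\<And>i. i < n \<Longrightarrow> \<omega> i = \<omega>' i"
  shows "\<bar>birkhoff f n \<omega> - birkhoff f n \<omega>'\<bar> \<le> C / (1 - \<theta>)"
proof -
  have C: "0 \<le> C" using f by (rule cylinder_lipschitz_nonneg)
  have "\<bar>birkhoff f n \<omega> - birkhoff f n \<omega>'\<bar> \<le> (\<Sum>j<n. \<bar>f ((left_shift ^^ j) \<omega>) - f ((left_shift ^^ j) \<omega>')\<bar>)"
    unfolding birkhoff_def sum_subtractf[symmetric] by (rule sum_abs)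
  also have "\<dots> \<le> (\<Sum>j<n. C * \<theta> ^ (n - j))"
    by (intro sum_mono cylinder_lipschitzD[OF f]) (auto simp: left_shift_funpow eq)
  also have "\<dots> = (\<Sum>j<n. C * \<theta> ^ Suc j)"
    by (rule sum.reindex_bij_witness[of _ "\<lambda>j. n - Suc j" "\<lambda>j. n - Suc j"]) (auto simp: Suc_diff_Suc)
  also have "\<dots> \<le> (\<Sum>j<n. C * \<theta> ^ j)"
    using C \<theta> by (intro sum_mono mult_left_mono power_decreasing) auto
  also have "\<dots> = C * ((1 - \<theta> ^ n) / (1 - \<theta>))"
    using \<theta> by (simp add: sum_distrib_left[symmetric] sum_gp_strict)
  also have "\<dots> \<le> C * (1 / (1 - \<theta>))" using C \<theta> by (intro mult_left_mono divide_right_mono) auto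
  finally show ?thesis by simp
qed

section \<open>Occupation times\<close>

definition occupation :: "(nat \<Rightarrow> real) \<Rightarrow> real set \<Rightarrow> nat \<Rightarrow> real" where
  "occupation y A n = (\<Sum>j<n. indicator A (y j))"

lemma occupation_nonneg [simp]: "0 \<le> occupation y A n"
  by (simp add: occupation_def sum_nonneg)

lemma occupation_le: "occupation y A n \<le> real n"
  unfolding occupation_def
  using sum_bounded_above[of "{..<n}" "\<lambda>j. indicator A (y j) :: real" 1] by (simp add: indicator_def)

lemma occupation_mono:
  "(\<And>j. j < n \<Longrightarrow> y j \<in> A \<Longrightarrow> z j \<in> B) \<Longrightarrow> occupation y A n \<le> occupation z B n"
  unfolding occupation_def by (intro sum_mono) (auto simp: indicator_def)

lemma occupation_add: "occupation y A (n + m) = occupation y A n + occupation (\<lambda>j. y (n + j)) A m"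
  unfolding occupation_def by (induction m) auto

lemma occupation_incseq: "n \<le> m \<Longrightarrow> occupation y A n \<le> occupation y A m"
  unfolding occupation_def by (rule sum_mono2) auto

lemma prob_ge_product:
  fixes p :: "'a pmf"
  assumes [measurable]: "E \<in> sets (bernoulli p)" "F \<in> sets (bernoulli p)" "G \<in> sets (bernoulli p)"
    and sub: "\<And>\<omega> \<omega>'. \<omega> \<in> E \<Longrightarrow> \<omega>' \<in> F \<Longrightarrow> comb_seq n \<omega> \<omega>' \<in> G"
  shows "measure (bernoulli p) E * measure (bernoulli p) F \<le> measure (bernoulli p) G"
proof -
  let ?P = "bernoulli p"
  have "measure ?P E * measure ?P F = (\<integral>\<omega>'. (\<integral>\<omega>. indicator E \<omega> \<partial>?P) * indicator F \<omega>' \<partial>?P)"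
    by simp
  also have "\<dots> \<le> (\<integral>\<omega>'. (\<integral>\<omega>. indicator G (comb_seq n \<omega> \<omega>') \<partial>?P) \<partial>?P)"
  proof (rule integral_mono)
    show "integrable ?P (\<lambda>\<omega>'. (\<integral>\<omega>. indicator E \<omega> \<partial>?P) * indicator F \<omega>' :: real)"
      by (intro integrable_bounded[where K=1]) (auto split: split_indicator)
    show "integrable ?P (\<lambda>\<omega>'. (\<integral>\<omega>. indicator G (comb_seq n \<omega> \<omega>') \<partial>?P) :: real)"
      by (intro integrable_bounded[where K=1] abs_integral_le) (auto simp: indicator_def)
    fix \<omega>'
    have "(\<integral>\<omega>. indicator E \<omega> \<partial>?P) * indicator F \<omega>' = (\<integral>\<omega>. indicator E \<omega> * indicator F \<omega>' \<partial>?P :: real)"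
      by (simp del: integral_indicator)
    also have "\<dots> \<le> (\<integral>\<omega>. indicator G (comb_seq n \<omega> \<omega>') \<partial>?P)"
      by (intro integral_mono integrable_bounded[where K=1]) (auto simp: indicator_def sub)
    finally show "(\<integral>\<omega>. indicator E \<omega> \<partial>?P) * indicator F \<omega>' \<le> (\<integral>\<omega>. indicator G (comb_seq n \<omega> \<omega>') \<partial>?P :: real)" .
  qed
  also have "\<dots> = (\<integral>\<omega>. indicator G \<omega> \<partial>?P)"
    by (rule integral_split[symmetric, where K=1]) (auto simp: indicator_def)
  finally show ?thesis by simp
qed

section \<open>Birkhoff sums with the reverse martingale property\<close>

text \<open>If \<open>\<psi>\<close> is annihilated by the transfer operator, then \<open>\<psi> \<circ>
  \<tau>\<^bsup>n-1\<^esup>\<close>, \<open>\<psi> \<circ> \<tau>\<^bsup>n-2\<^esup>\<close>,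
  \<open>\<dots>\<close>, \<open>\<psi>\<close> are martingale differences for the filtration
  generated by the tails of \<open>\<omega>\<close>, read from right to left. So for each
  \<open>n\<close> the sum \<open>birkhoff \<psi> n\<close> is the last value of a martingale with
  bounded increments, although the sequence of these sums is not a martingale itself. Martingale
  arguments give estimates for the law of the sum at each single time; the almost sure statements
  are derived from these estimates.\<close>

locale reverse_martingale =
  fixes p :: "'a::finite pmf" and \<psi> :: "(nat \<Rightarrow> 'a) \<Rightarrow> real" and C \<theta> :: real
  assumes lip: "cylinder_lipschitz C \<theta> \<psi>" and theta: "0 < \<theta>" "\<theta> < 1"
    and zero: "\<And>\<omega>. transfer p 1 \<psi> \<omega> = 0"
    and nontriv: "(\<integral>\<omega>. (\<psi> \<omega>)\<^sup>2 \<partial>bernoulli p) > 0"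
begin

abbreviation "P \<equiv> bernoulli p"
abbreviation "S \<equiv> birkhoff \<psi>"
text \<open>\<open>D\<close> is the distortion constant of \<open>birkhoff_near\<close>, and \<open>v\<close>
  is the variance of one increment, which by orthogonality is the asymptotic variance of the
  Birkhoff sums.\<close>

definition "D = C / (1 - \<theta>)"
definition "v = (\<integral>\<omega>. (\<psi> \<omega>)\<^sup>2 \<partial>bernoulli p)"

lemma v_pos: "0 < v" using nontriv by (simp add: v_def)

lemma C_nonneg: "0 \<le> C" using lip by (rule cylinder_lipschitz_nonneg)

lemma D_nonneg: "0 \<le> D" using C_nonneg theta by (simp add: D_def)

lemma psi_measurable [measurable]: "\<psi> \<in> borel_measurable P"
  using lip theta by (rule cylinder_lipschitz_measurable)

lemma psi_bounded: "\<bar>\<psi> \<omega>\<bar> \<le> C"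
proof -
  have i: "integrable P (\<lambda>\<omega>1. \<psi> (comb_seq 1 \<omega>1 \<omega>))"
  proof (rule integrable_bounded)
    show "\<bar>\<psi> (comb_seq 1 \<omega>1 \<omega>)\<bar> \<le> \<bar>\<psi> undefined\<bar> + C" for \<omega>1
      using cylinder_lipschitz_osc[OF lip, of "comb_seq 1 \<omega>1 \<omega>" undefined] by linarith
  qed measurable
  have "\<psi> \<omega> = (\<integral>\<omega>1. \<psi> \<omega> - \<psi> (comb_seq 1 \<omega>1 \<omega>) \<partial>P)"
    using zero[of \<omega>] i by (simp add: transfer_def del: comb_seq_Suc_0 One_nat_def)
  moreover have "\<bar>\<integral>\<omega>1. \<psi> \<omega> - \<psi> (comb_seq 1 \<omega>1 \<omega>) \<partial>P\<bar> \<le> C"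
    by (rule abs_integral_le) (rule cylinder_lipschitz_osc[OF lip])
  ultimately show ?thesis by simp
qed

lemma S_bounded: "\<bar>S n \<omega>\<bar> \<le> real n * C"
  by (rule birkhoff_bounded) (rule psi_bounded)

lemma S_near: "(\<And>i. i < n \<Longrightarrow> \<omega> i = \<omega>' i) \<Longrightarrow> \<bar>S n \<omega> - S n \<omega>'\<bar> \<le> D"
  unfolding D_def by (rule birkhoff_near[OF lip theta])

lemma S_comb_near: "j \<le> n \<Longrightarrow> \<bar>S j (comb_seq n \<omega> \<omega>') - S j \<omega>\<bar> \<le> D"
  by (rule S_near) (simp add: comb_seq_def)

lemma S_comb: "S (n + m) (comb_seq n \<omega> \<omega>') = S n (comb_seq n \<omega> \<omega>') + S m \<omega>'"
  by (simp add: birkhoff_add)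

lemma S_1: "S 1 \<omega> = \<psi> \<omega>"
  by (simp add: birkhoff_def)

lemma integrable_S [simp]: "integrable P (S n)"
  by (rule integrable_bounded[where K="real n * C"]) (auto intro: S_bounded)

lemma integrable_S_comb [simp]: "integrable P (\<lambda>\<omega>. S n (comb_seq m \<omega> \<omega>'))"
  by (rule integrable_bounded[where K="real n * C"]) (auto intro: S_bounded)

lemma S_sq_bounded: "(S n \<omega>)\<^sup>2 \<le> (real n * C)\<^sup>2"
  using S_bounded[of n \<omega>] by (rule power2_le_iff_abs_le[THEN iffD2, rotated]) (simp add: C_nonneg)

lemma integrable_S_sq [simp]: "integrable P (\<lambda>\<omega>. (S n \<omega>)\<^sup>2)"
  by (rule integrable_bounded[where K="(real n * C)\<^sup>2"]) (auto intro: S_sq_bounded)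

lemma integrable_S_comb_sq [simp]: "integrable P (\<lambda>\<omega>. (S n (comb_seq m \<omega> \<omega>'))\<^sup>2)"
  by (rule integrable_bounded[where K="(real n * C)\<^sup>2"]) (auto intro: S_sq_bounded)

text \<open>The martingale property: conditionally on the tail, a block of \<open>n\<close> increments has
  mean zero.\<close>

lemma transfer_S: "transfer p n (S n) \<omega>' = 0"
proof (induction n arbitrary: \<omega>')
  case 0
  then show ?case by (simp add: transfer_def)
next
  case (Suc n)
  have "transfer p 1 (S (1 + n)) \<omega> = S n \<omega>" for \<omega>
  proof -
    have "transfer p 1 (S (1 + n)) \<omega> = (\<integral>\<omega>1. S 1 (comb_seq 1 \<omega>1 \<omega>) + S n \<omega> \<partial>P)"
      unfolding transfer_def S_comb ..
    also have "\<dots> = (\<integral>\<omega>1. S 1 (comb_seq 1 \<omega>1 \<omega>) \<partial>P) + S n \<omega>"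
      by (subst Bochner_Integration.integral_add) (simp_all del: comb_seq_Suc_0 One_nat_def)
    also have "(\<integral>\<omega>1. S 1 (comb_seq 1 \<omega>1 \<omega>) \<partial>P) = 0"
      using zero[of \<omega>] unfolding transfer_def S_1 .
    finally show ?thesis by simp
  qed
  then have "transfer p 1 (S (1 + n)) = S n" by (rule ext)
  then have "transfer p (1 + n) (S (1 + n)) = transfer p n (S n)"
    by (subst transfer_transfer[symmetric, where K="real (1 + n) * C"])
      (simp_all only: psi_measurable measurable_birkhoff S_bounded)
  then show ?case using Suc by simp
qed

lemma integral_S_comb: "(\<integral>\<omega>. S n (comb_seq n \<omega> \<omega>') \<partial>P) = 0"
  using transfer_S[of n \<omega>'] by (simp add: transfer_def)

lemma mean_S: "(\<integral>\<omega>. S n \<omega> \<partial>P) = 0"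
  by (subst integral_split[where n=n and K="real n * C"]) (auto simp: integral_S_comb intro: S_bounded)

text \<open>Orthogonality of martingale increments.\<close>

lemma second_moment: "(\<integral>\<omega>. (S n \<omega>)\<^sup>2 \<partial>P) = real n * v"
proof (induction n)
  case 0
  then show ?case by simp
next
  case (Suc n)
  have "(\<integral>\<omega>. (S (1 + n) (comb_seq 1 \<omega> \<omega>'))\<^sup>2 \<partial>P) = (\<integral>\<omega>. (S 1 (comb_seq 1 \<omega> \<omega>'))\<^sup>2 \<partial>P) + (S n \<omega>')\<^sup>2" for \<omega>'
  proof -
    have "(\<integral>\<omega>. (S (1 + n) (comb_seq 1 \<omega> \<omega>'))\<^sup>2 \<partial>P) =
        (\<integral>\<omega>. (S 1 (comb_seq 1 \<omega> \<omega>'))\<^sup>2 + (2 * S n \<omega>' * S 1 (comb_seq 1 \<omega> \<omega>') + (S n \<omega>')\<^sup>2) \<partial>P)"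
      unfolding S_comb by (intro Bochner_Integration.integral_cong refl) (simp add: power2_eq_square algebra_simps)
    also have "\<dots> = (\<integral>\<omega>. (S 1 (comb_seq 1 \<omega> \<omega>'))\<^sup>2 \<partial>P) + (2 * S n \<omega>' * (\<integral>\<omega>. S 1 (comb_seq 1 \<omega> \<omega>') \<partial>P) + (S n \<omega>')\<^sup>2)"
      by (simp del: comb_seq_Suc_0 One_nat_def)
    finally show ?thesis by (simp only: integral_S_comb mult_zero_right add_0)
  qed
  note step = this
  have "(\<integral>\<omega>. (S (1 + n) \<omega>)\<^sup>2 \<partial>P) = (\<integral>\<omega>'. (\<integral>\<omega>. (S (1 + n) (comb_seq 1 \<omega> \<omega>'))\<^sup>2 \<partial>P) \<partial>P)"
    by (rule integral_split[where K="(real (1 + n) * C)\<^sup>2"])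
       (simp_all only: abs_power2 S_sq_bounded, measurable)
  also have "\<dots> = (\<integral>\<omega>'. (\<integral>\<omega>. (S 1 (comb_seq 1 \<omega> \<omega>'))\<^sup>2 \<partial>P) + (S n \<omega>')\<^sup>2 \<partial>P)"
    by (simp only: step)
  also have "\<dots> = (\<integral>\<omega>'. (\<integral>\<omega>. (S 1 (comb_seq 1 \<omega> \<omega>'))\<^sup>2 \<partial>P) \<partial>P) + (\<integral>\<omega>'. (S n \<omega>')\<^sup>2 \<partial>P)"
  proof (rule Bochner_Integration.integral_add)
    show "integrable P (\<lambda>\<omega>'. \<integral>\<omega>. (S 1 (comb_seq 1 \<omega> \<omega>'))\<^sup>2 \<partial>P)"
      by (rule integrable_bounded[where K="(real 1 * C)\<^sup>2"])
        (measurable, rule abs_integral_le, simp only: abs_power2 S_sq_bounded)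
  qed simp
  also have "(\<integral>\<omega>'. (\<integral>\<omega>. (S 1 (comb_seq 1 \<omega> \<omega>'))\<^sup>2 \<partial>P) \<partial>P) = (\<integral>\<omega>. (S 1 \<omega>)\<^sup>2 \<partial>P)"
    by (rule integral_split[symmetric, where K="(real 1 * C)\<^sup>2"])
       (simp_all only: abs_power2 S_sq_bounded, measurable)
  also have "\<dots> = v" by (simp only: S_1 v_def)
  finally show ?case using Suc by (simp add: algebra_simps)
qed

text \<open>The conditional variance of a single increment given the tail may vanish for some tails. That of a
  long block cannot, because by bounded distortion it hardly depends on the tail, and its average
  over all tails is \<open>n * v\<close>.\<close>

lemma block_variance: "real n * v / 2 - D\<^sup>2 \<le> (\<integral>\<omega>. (S n (comb_seq n \<omega> \<omega>'))\<^sup>2 \<partial>P)" (is "_ \<le> ?W")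
proof -
  have *: "(\<integral>\<omega>. (S n (comb_seq n \<omega> \<omega>''))\<^sup>2 \<partial>P) \<le> 2 * ?W + 2 * D\<^sup>2" for \<omega>''
  proof -
    have "(S n (comb_seq n \<omega> \<omega>''))\<^sup>2 \<le> 2 * (S n (comb_seq n \<omega> \<omega>'))\<^sup>2 + 2 * D\<^sup>2" for \<omega>
    proof -
      let ?a = "S n (comb_seq n \<omega> \<omega>')" and ?b = "S n (comb_seq n \<omega> \<omega>'')"
      have "\<bar>?b - ?a\<bar> \<le> D" by (rule S_near) (simp add: comb_seq_def)
      then have "(?b - ?a)\<^sup>2 \<le> D\<^sup>2" using power2_le_iff_abs_le D_nonneg by blast
      moreover have "?b\<^sup>2 + (?b - 2 * ?a)\<^sup>2 = 2 * ?a\<^sup>2 + 2 * (?b - ?a)\<^sup>2" by (simp add: power2_eq_square algebra_simps)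
      ultimately show ?thesis using zero_le_power2[of "?b - 2 * ?a"] by linarith
    qed
    then have "(\<integral>\<omega>. (S n (comb_seq n \<omega> \<omega>''))\<^sup>2 \<partial>P) \<le> (\<integral>\<omega>. 2 * (S n (comb_seq n \<omega> \<omega>'))\<^sup>2 + 2 * D\<^sup>2 \<partial>P)"
      by (intro integral_mono) auto
    then show ?thesis by simp
  qed
  have "real n * v = (\<integral>\<omega>''. (\<integral>\<omega>. (S n (comb_seq n \<omega> \<omega>''))\<^sup>2 \<partial>P) \<partial>P)"
    unfolding second_moment[symmetric]
    by (rule integral_split[where K="(real n * C)\<^sup>2"]) (auto intro: S_sq_bounded)
  also have "\<dots> \<le> (\<integral>\<omega>''. 2 * ?W + 2 * D\<^sup>2 \<partial>P)"
  proof (rule integral_mono)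
    show "integrable P (\<lambda>\<omega>'. \<integral>\<omega>. (S n (comb_seq n \<omega> \<omega>'))\<^sup>2 \<partial>P)"
      by (rule integrable_bounded[where K="(real n * C)\<^sup>2"])
        (measurable, rule abs_integral_le, use S_sq_bounded in simp)
  qed (use * in auto)
  finally show ?thesis by simp
qed

text \<open>The Cauchy--Schwarz inequality, in the form of the arithmetic-geometric mean inequality with the
  parameter \<open>s\<close>.\<close>

lemma mean_abs_S:
  assumes "0 < s" "real n * v \<le> s\<^sup>2"
  shows "(\<integral>\<omega>. \<bar>S n \<omega>\<bar> \<partial>P) \<le> s"
proof -
  have pt: "\<bar>x\<bar> \<le> x\<^sup>2 / (2 * s) + s / 2" for x :: real
  proof -
    have "2 * s * \<bar>x\<bar> \<le> x\<^sup>2 + s\<^sup>2" using sum_squares_bound[of s "\<bar>x\<bar>"] by simp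
    then show ?thesis using assms(1) by (simp add: field_simps power2_eq_square)
  qed
  have "(\<integral>\<omega>. \<bar>S n \<omega>\<bar> \<partial>P) \<le> (\<integral>\<omega>. (S n \<omega>)\<^sup>2 / (2 * s) + s / 2 \<partial>P)"
    using pt by (intro integral_mono) auto
  also have "\<dots> = real n * v / (2 * s) + s / 2" by (simp add: second_moment)
  also have "\<dots> \<le> s\<^sup>2 / (2 * s) + s / 2" using assms by (intro add_mono divide_right_mono) auto
  also have "\<dots> = s" using assms by (simp add: power2_eq_square)
  finally show ?thesis .
qed

lemma block_length_exists: "\<exists>N>0. \<forall>\<omega>'. 1 \<le> (\<integral>\<omega>. (S N (comb_seq N \<omega> \<omega>'))\<^sup>2 \<partial>P)"
proof -
  obtain N :: nat where N: "(D\<^sup>2 + 1) / (v / 2) < real N" using reals_Archimedean2 by blast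
  then have "D\<^sup>2 + 1 < real N * v / 2" using v_pos by (simp add: field_simps)
  moreover have "N > 0"
  proof (rule ccontr)
    assume "\<not> N > 0"
    then show False using \<open>D\<^sup>2 + 1 < real N * v / 2\<close> zero_le_power2[of D] by simp
  qed
  moreover have "1 \<le> (\<integral>\<omega>. (S N (comb_seq N \<omega> \<omega>'))\<^sup>2 \<partial>P)" for \<omega>'
    using block_variance[of N \<omega>'] \<open>D\<^sup>2 + 1 < real N * v / 2\<close> by linarith
  ultimately show ?thesis by blast
qed

end

section \<open>Time spent at bounded height\<close>

text \<open>The Huber function is \<open>x\<^sup>2\<close> on \<open>[-R, R]\<close> and continues linearly
  with slope \<open>2 R\<close> in absolute value. It is the supremum of the tangents \<open>2 r x
  - r\<^sup>2\<close> with \<open>\<bar>r\<bar> \<le> R\<close>; the maximum is attained where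
  \<open>r\<close> is \<open>x\<close> clipped to \<open>[-R, R]\<close>. This representation
  gives the convexity estimates without derivatives.\<close>

definition clip :: "real \<Rightarrow> real \<Rightarrow> real" where
  "clip R x = max (- R) (min R x)"

definition huber :: "real \<Rightarrow> real \<Rightarrow> real" where
  "huber R x = 2 * clip R x * x - (clip R x)\<^sup>2"

lemma clip_measurable [measurable]: "clip R \<in> borel_measurable borel"
  unfolding clip_def by measurable

lemma huber_measurable [measurable]: "huber R \<in> borel_measurable borel"
  unfolding huber_def by measurable

lemma abs_clip_le: "0 \<le> R \<Longrightarrow> \<bar>clip R x\<bar> \<le> R"
  by (auto simp: clip_def)

lemma clip_eq: "\<bar>x\<bar> \<le> R \<Longrightarrow> clip R x = x"
  by (auto simp: clip_def)

lemma huber_support: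
  assumes "\<bar>r\<bar> \<le> R"
  shows "2 * r * x - r\<^sup>2 \<le> huber R x"
proof -
  have "\<bar>x - clip R x\<bar> \<le> \<bar>x - r\<bar>" using assms by (auto simp: clip_def)
  then have "(x - clip R x)\<^sup>2 \<le> (x - r)\<^sup>2" by (simp add: abs_le_square_iff)
  then show ?thesis by (simp add: huber_def power2_eq_square algebra_simps)
qed

lemma huber_eq: "\<bar>x\<bar> \<le> R \<Longrightarrow> huber R x = x\<^sup>2"
  by (simp add: huber_def clip_eq power2_eq_square)

lemma huber_nonneg: "0 \<le> R \<Longrightarrow> 0 \<le> huber R x"
  using huber_support[of 0 R x] by simp

lemma huber_le: "0 \<le> R \<Longrightarrow> huber R x \<le> 2 * R * \<bar>x\<bar>"
proof -
  assume R: "0 \<le> R"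
  have "huber R x \<le> 2 * (clip R x * x)" by (simp add: huber_def)
  also have "clip R x * x \<le> \<bar>clip R x\<bar> * \<bar>x\<bar>" by (simp add: abs_mult[symmetric])
  also have "\<dots> \<le> R * \<bar>x\<bar>" using abs_clip_le[OF R] by (intro mult_right_mono) auto
  finally show ?thesis by simp
qed

text \<open>A second order Taylor estimate whose quadratic term is kept only for \<open>x\<close> in
  \<open>[-M, M]\<close>, where the step \<open>h\<close> does not leave the region in which the
  Huber function is the square.\<close>

lemma huber_increment:
  assumes "0 \<le> M" "\<bar>h\<bar> \<le> H"
  shows "huber (M + H) x + 2 * clip (M + H) x * h + indicator {-M..M} x * h\<^sup>2 \<le> huber (M + H) (x + h)"
proof (cases "x \<in> {-M..M}")
  case True
  then have "\<bar>x\<bar> \<le> M" by auto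
  then have "\<bar>x\<bar> \<le> M + H" "\<bar>x + h\<bar> \<le> M + H" using assms by linarith+
  then show ?thesis using True by (simp add: huber_eq clip_eq power2_eq_square algebra_simps)
next
  case False
  have "0 \<le> M + H" using assms by linarith
  from huber_support[OF abs_clip_le[OF this], of x "x + h"] False
  show ?thesis by (simp add: huber_def algebra_simps)
qed

context reverse_martingale
begin

text \<open>Evaluate a Huber function along the walk. Adding one block of \<open>N\<close> increments never
  decreases the expected value, and raises it by at least the probability of being in \<open>[-M,
  M]\<close>, since the conditional variance of a block is at least \<open>1\<close>. After
  \<open>n\<close> steps the expected value is still only of order \<open>sqrt n\<close> because
  the Huber function grows linearly. Hence so is the expected time spent in \<open>[-M,
  M]\<close>. The dependence on \<open>M\<close> is explicit because this is also used with
  \<open>M\<close> of order \<open>sqrt n\<close>.\<close>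

lemma occupation_probability_sum:
  "\<exists>A N. 0 < A \<and> 0 < N \<and> (\<forall>M n. 0 \<le> M \<longrightarrow>
     (\<Sum>k<n. measure P {\<omega>. S k \<omega> \<in> {-M..M}}) \<le> A * (M + real N * C) * sqrt (real (n + N)))"
proof -
  obtain N where N: "N > 0" and var: "\<And>\<omega>'. 1 \<le> (\<integral>\<omega>. (S N (comb_seq N \<omega> \<omega>'))\<^sup>2 \<partial>P)"
    using block_length_exists by blast
  have "(\<Sum>k<n. measure P {\<omega>. S k \<omega> \<in> {-M..M}}) \<le> (2 * real N * sqrt v) * (M + real N * C) * sqrt (real (n + N))"
    if M: "0 \<le> M" for M n
  proof -
    define R where "R = M + real N * C"
    have R: "0 \<le> R" using M C_nonneg by (simp add: R_def)
    define g where "g = (\<lambda>k. \<integral>\<omega>. huber R (S k \<omega>) \<partial>P)"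
    have hb: "\<bar>huber R (S k \<omega>)\<bar> \<le> 2 * R * (real k * C)" for k \<omega>
      using huber_nonneg[OF R, of "S k \<omega>"] huber_le[OF R, of "S k \<omega>"]
        mult_left_mono[OF S_bounded[of k \<omega>], of "2 * R"] R by simp
    have int: "integrable P (\<lambda>\<omega>. huber R (S k \<omega>))" for k
      by (rule integrable_bounded[OF _ hb]) measurable
    have gain: "g k + measure P {\<omega>. S k \<omega> \<in> {-M..M}} \<le> g (k + N)" for k
    proof -
      have pt: "huber R (S k \<omega>') + indicator {-M..M} (S k \<omega>') \<le> (\<integral>\<omega>. huber R (S (N + k) (comb_seq N \<omega> \<omega>')) \<partial>P)" for \<omega>'
      proof -
        let ?x = "S k \<omega>'" and ?h = "\<lambda>\<omega>. S N (comb_seq N \<omega> \<omega>')"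
        have "huber R ?x + indicator {-M..M} ?x * 1
          \<le> huber R ?x + indicator {-M..M} ?x * (\<integral>\<omega>. (?h \<omega>)\<^sup>2 \<partial>P)"
          using var[of \<omega>'] by (intro add_left_mono mult_left_mono) auto
        also have "\<dots> = (\<integral>\<omega>. huber R ?x + 2 * clip R ?x * ?h \<omega> + indicator {-M..M} ?x * (?h \<omega>)\<^sup>2 \<partial>P)"
          by (simp add: integral_S_comb)
        also have "\<dots> \<le> (\<integral>\<omega>. huber R (?x + ?h \<omega>) \<partial>P)"
        proof (rule integral_mono)
          have "integrable P (\<lambda>\<omega>. huber R (S (N + k) (comb_seq N \<omega> \<omega>')))"
            by (rule integrable_bounded[OF _ hb]) measurable
          then show "integrable P (\<lambda>\<omega>. huber R (?x + ?h \<omega>))" by (simp add: S_comb add.commute)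
        qed (auto simp: R_def intro!: huber_increment M S_bounded)
        finally show ?thesis by (simp add: S_comb add.commute)
      qed
      have "g k + measure P {\<omega>. S k \<omega> \<in> {-M..M}} = (\<integral>\<omega>. huber R (S k \<omega>) \<partial>P) + (\<integral>\<omega>. indicator {\<omega>. S k \<omega> \<in> {-M..M}} \<omega> \<partial>P)"
        by (simp add: g_def)
      also have "(\<integral>\<omega>. indicator {\<omega>. S k \<omega> \<in> {-M..M}} \<omega> \<partial>P) = (\<integral>\<omega>. indicator {-M..M} (S k \<omega>) \<partial>P :: real)"
        by (intro Bochner_Integration.integral_cong) (auto simp: indicator_def)
      also have "(\<integral>\<omega>. huber R (S k \<omega>) \<partial>P) + \<dots> = (\<integral>\<omega>'. huber R (S k \<omega>') + indicator {-M..M} (S k \<omega>') \<partial>P)"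
        by (intro Bochner_Integration.integral_add[symmetric] int integrable_bounded[where K=1])
           (auto simp: indicator_def)
      also have "\<dots> \<le> (\<integral>\<omega>'. (\<integral>\<omega>. huber R (S (N + k) (comb_seq N \<omega> \<omega>')) \<partial>P) \<partial>P)"
      proof (rule integral_mono)
        show "integrable P (\<lambda>\<omega>'. huber R (S k \<omega>') + indicator {-M..M} (S k \<omega>'))"
          by (intro Bochner_Integration.integrable_add int integrable_bounded[where K=1])
             (auto simp: indicator_def)
        show "integrable P (\<lambda>\<omega>'. \<integral>\<omega>. huber R (S (N + k) (comb_seq N \<omega> \<omega>')) \<partial>P)"
          by (rule integrable_bounded) (measurable, rule abs_integral_le, rule hb)
      qed (rule pt)
      also have "\<dots> = (\<integral>\<omega>. huber R (S (N + k) \<omega>) \<partial>P)"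
        by (rule integral_split[symmetric, OF _ hb]) measurable
      finally show ?thesis by (simp add: g_def add.commute)
    qed
    have "(\<Sum>k<n. measure P {\<omega>. S k \<omega> \<in> {-M..M}}) + (\<Sum>k<N. g k) \<le> (\<Sum>k<N. g (n + k))"
    proof (induction n)
      case (Suc n)
      have "(\<Sum>k<N. g (Suc n + k)) + g n = (\<Sum>k<Suc N. g (n + k))"
        by (subst sum.lessThan_Suc_shift) simp
      also have "\<dots> = (\<Sum>k<N. g (n + k)) + g (n + N)" by simp
      finally show ?case using Suc gain[of n] by simp
    qed simp
    moreover have "0 \<le> (\<Sum>k<N. g k)"
      by (auto simp: g_def intro!: sum_nonneg Bochner_Integration.integral_nonneg huber_nonneg R)
    moreover have "(\<Sum>k<N. g (n + k)) \<le> real N * (2 * R * (sqrt v * sqrt (real (n + N))))"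
    proof -
      have "g (n + k) \<le> 2 * R * (sqrt v * sqrt (real (n + N)))" if "k < N" for k
      proof -
        have "g (n + k) \<le> (\<integral>\<omega>. 2 * R * \<bar>S (n + k) \<omega>\<bar> \<partial>P)"
          unfolding g_def by (intro integral_mono int huber_le R) auto
        also have "\<dots> = 2 * R * (\<integral>\<omega>. \<bar>S (n + k) \<omega>\<bar> \<partial>P)" by simp
        also have "\<dots> \<le> 2 * R * (sqrt v * sqrt (real (n + N)))"
          using R v_pos N that
          by (intro mult_left_mono mean_abs_S) (auto simp: power_mult_distrib)
        finally show ?thesis .
      qed
      then show ?thesis using sum_bounded_above[of "{..<N}" "\<lambda>k. g (n + k)"] by simp
    qed
    ultimately show ?thesis by (simp add: R_def algebra_simps)
  qed
  then show ?thesis using N v_pos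
    by (intro exI[of _ "2 * real N * sqrt v"] exI[of _ N]) auto
qed

lemma integral_occupation:
  assumes [measurable]: "A \<in> sets borel"
  shows "(\<integral>\<omega>. occupation (\<lambda>j. S j \<omega>) A n \<partial>P) = (\<Sum>k<n. measure P {\<omega>. S k \<omega> \<in> A})"
proof -
  have "(\<integral>\<omega>. occupation (\<lambda>j. S j \<omega>) A n \<partial>P) = (\<Sum>k<n. \<integral>\<omega>. indicator A (S k \<omega>) \<partial>P)"
    unfolding occupation_def
    by (intro Bochner_Integration.integral_sum integrable_bounded[where K=1]) (auto simp: indicator_def)
  also have "\<dots> = (\<Sum>k<n. \<integral>\<omega>. indicator {\<omega>. S k \<omega> \<in> A} \<omega> \<partial>P)"
    by (intro sum.cong Bochner_Integration.integral_cong) (auto simp: indicator_def)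
  also have "\<dots> = (\<Sum>k<n. measure P {\<omega>. S k \<omega> \<in> A})" by simp
  finally show ?thesis .
qed

end

lemma occupation_measurable [measurable]:
  assumes [measurable]: "\<And>j. (\<lambda>\<omega>. y \<omega> j) \<in> borel_measurable N" "A \<in> sets borel"
  shows "(\<lambda>\<omega>. occupation (y \<omega>) A n) \<in> borel_measurable N"
  unfolding occupation_def by measurable

lemma density_zero_along_powers:
  fixes c :: "nat \<Rightarrow> real"
  assumes mono: "\<And>n m. n \<le> m \<Longrightarrow> c n \<le> c m" and nonneg: "\<And>n. 0 \<le> c n"
    and lim: "(\<lambda>k. c (4 ^ k) / 4 ^ k) \<longlonglongrightarrow> 0"
  shows "(\<lambda>n. c n / real n) \<longlonglongrightarrow> 0"
proof (rule LIMSEQ_I)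
  fix r :: real assume r: "0 < r"
  then obtain K where K: "\<And>k. K \<le> k \<Longrightarrow> norm (c (4 ^ k) / 4 ^ k - 0) < r / 4"
    using LIMSEQ_D[OF lim, of "r/4"] by auto
  show "\<exists>no. \<forall>n\<ge>no. norm (c n / real n - 0) < r"
  proof (intro exI[of _ "4 ^ K"] allI impI)
    fix n :: nat assume n: "4 ^ K \<le> n"
    have "1 \<le> (4::nat) ^ K" by simp
    then have n1: "1 \<le> n" using n by linarith
    obtain k where k: "4 ^ k \<le> n" "n < 4 ^ (k + 1)" using ex_power_ivl1[of 4 n] n1 by auto
    have "(4::nat) ^ K < 4 ^ (k + 1)" using n k by linarith
    then have "K \<le> k + 1" using power_less_imp_less_exp[of "4::nat" K "k+1"] by simp
    then have "c (4 ^ (k + 1)) / 4 ^ (k + 1) < r / 4"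
      using K[of "k + 1"] abs_ge_self[of "c (4 ^ (k + 1)) / 4 ^ (k + 1)"] unfolding real_norm_def by linarith
    then have "c (4 ^ (k + 1)) < r * 4 ^ k" by (simp add: field_simps)
    moreover have "c n \<le> c (4 ^ (k + 1))" using k by (intro mono) simp
    moreover have "r * 4 ^ k \<le> r * real n" using k r by (intro mult_left_mono) (auto simp flip: of_nat_power_le_of_nat_cancel_iff)
    ultimately have "c n < r * real n" by linarith
    then show "norm (c n / real n - 0) < r" using n1 nonneg[of n] by (simp add: field_simps)
  qed
qed

context reverse_martingale
begin

text \<open>The expected fraction of time spent in \<open>[-M, M]\<close> up to time \<open>4 ^ k\<close> is
  at most of order \<open>2 ^ (- k)\<close>, which is summable, so these fractions tend to zero
  almost surely; the times in between are controlled by monotonicity of the occupation time.\<close>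

lemma AE_bounded_density_zero:
  "AE \<omega> in P. \<forall>M::nat. (\<lambda>n. occupation (\<lambda>j. S j \<omega>) {- real M..real M} n / real n) \<longlonglongrightarrow> 0"
proof (subst AE_all_countable, intro allI)
  fix M :: nat
  define f where "f = (\<lambda>k \<omega>. occupation (\<lambda>j. S j \<omega>) {- real M..real M} (4 ^ k) / 4 ^ k)"
  obtain A N where A: "0 < A" and N: "0 < N" and
    occ: "\<And>M n. 0 \<le> M \<Longrightarrow> (\<Sum>k<n. measure P {\<omega>. S k \<omega> \<in> {-M..M}}) \<le> A * (M + real N * C) * sqrt (real (n + N))"
    using occupation_probability_sum by blast
  define B where "B = A * (real M + real N * C) * sqrt (1 + real N)"
  have B: "0 \<le> B" using A C_nonneg by (simp add: B_def)
  have [measurable]: "f k \<in> borel_measurable P" for k unfolding f_def by measurable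
  have f0: "0 \<le> f k \<omega>" for k \<omega> by (simp add: f_def)
  have f1: "f k \<omega> \<le> 1" for k \<omega>
    using occupation_le[of "\<lambda>j. S j \<omega>" _ "4 ^ k"] by (simp add: f_def)
  have fi: "integrable P (f k)" for k
    by (rule integrable_bounded[where K=1]) (auto simp: f0 f1)
  have "(\<integral>\<omega>. f k \<omega> \<partial>P) \<le> B * (1 / 2) ^ k" for k
  proof -
    have "(\<integral>\<omega>. f k \<omega> \<partial>P) = (\<Sum>j<4 ^ k. measure P {\<omega>. S j \<omega> \<in> {- real M..real M}}) / 4 ^ k"
      unfolding f_def by (subst integral_occupation[symmetric]) auto
    also have "\<dots> \<le> (A * (real M + real N * C) * sqrt (real (4 ^ k + N))) / 4 ^ k"
      by (intro divide_right_mono occ) auto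
    also have "\<dots> \<le> (A * (real M + real N * C) * sqrt (4 ^ k * (1 + real N))) / 4 ^ k"
    proof -
      have "real N * 1 \<le> real N * 4 ^ k" by (intro mult_left_mono) auto
      then show ?thesis using A C_nonneg
        by (intro divide_right_mono mult_left_mono real_sqrt_le_mono) (auto simp: algebra_simps)
    qed
    also have "\<dots> = B * (2 ^ k / 4 ^ k)"
    proof -
      have "sqrt ((4::real) ^ k) = 2 ^ k" by (simp add: real_sqrt_power)
      then show ?thesis by (simp add: B_def real_sqrt_mult)
    qed
    also have "(2::real) ^ k / 4 ^ k = (1 / 2) ^ k" by (simp flip: power_divide)
    finally show ?thesis .
  qed
  then have "(\<Sum>k. \<integral>\<^sup>+\<omega>. ennreal (f k \<omega>) \<partial>P) \<le> (\<Sum>k. ennreal (B * (1 / 2) ^ k))"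
    by (intro suminf_le) (auto simp: nn_integral_eq_integral[OF fi] f0 ennreal_leI)
  also have "\<dots> = ennreal (\<Sum>k. B * (1 / 2) ^ k)"
    by (rule suminf_ennreal2) (auto simp: B intro!: summable_mult summable_geometric)
  finally have "(\<integral>\<^sup>+\<omega>. (\<Sum>k. ennreal (f k \<omega>)) \<partial>P) < \<infinity>"
    by (subst nn_integral_suminf) (auto intro: le_less_trans)
  then have "AE \<omega> in P. (\<Sum>k. ennreal (f k \<omega>)) \<noteq> \<infinity>"
    by (intro nn_integral_PInf_AE) auto
  then show "AE \<omega> in P. (\<lambda>n. occupation (\<lambda>j. S j \<omega>) {- real M..real M} n / real n) \<longlonglongrightarrow> 0"
  proof eventually_elim
    case (elim \<omega>)
    then have "summable (\<lambda>k. f k \<omega>)"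
      by (intro summable_suminf_not_top) (auto simp: f0)
    then have "(\<lambda>k. f k \<omega>) \<longlonglongrightarrow> 0" by (rule summable_LIMSEQ_zero)
    then show ?case unfolding f_def
      by (intro density_zero_along_powers occupation_incseq occupation_nonneg)
  qed
qed

end

section \<open>Long excursions to one side\<close>

text \<open>A form of the second Borel--Cantelli lemma. An attempt to enter \<open>G s\<close>, started at
  time \<open>s\<close>, succeeds with probability at least \<open>\<delta>\<close> whatever the
  coordinates from \<open>s + l s\<close> on are; the next attempt starts at that time. So the
  first \<open>k\<close> attempts all fail with probability at most \<open>(1 - \<delta>) ^
  k\<close>.\<close>

lemma AE_shifted_hit:
  fixes p :: "'a pmf"
  assumes \<delta>: "0 < \<delta>" and G [measurable]: "\<And>s. G s \<in> sets (bernoulli p)"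
    and hit: "\<And>s \<omega>'. \<delta> \<le> measure (bernoulli p) {\<omega>. comb_seq (l s) \<omega> \<omega>' \<in> G s}"
  shows "AE \<omega> in bernoulli p. \<exists>s. (left_shift ^^ s) \<omega> \<in> G s"
proof -
  let ?P = "bernoulli p"
  have \<delta>1: "\<delta> \<le> 1" using hit[of 0 undefined] B.prob_le_1 order_trans by blast
  \<comment> \<open>For attempts started from time \<open>s\<close> on; the current sequence is then the original one
    shifted by \<open>s\<close>.\<close>
  have avoid: "\<exists>B\<in>sets ?P. measure ?P B \<le> (1 - \<delta>) ^ k \<and> (\<forall>\<omega>. (\<forall>j. (left_shift ^^ j) \<omega> \<notin> G (s + j)) \<longrightarrow> \<omega> \<in> B)" for k s
  proof (induction k arbitrary: s)
    case 0
    have "UNIV \<in> sets ?P" using sets.top[of ?P] by simp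
    then show ?case by (intro bexI[of _ UNIV]) auto
  next
    case (Suc k)
    obtain B where B [measurable]: "B \<in> sets ?P" and mB: "measure ?P B \<le> (1 - \<delta>) ^ k"
      and BB: "\<And>\<omega>. (\<forall>j. (left_shift ^^ j) \<omega> \<notin> G (s + l s + j)) \<Longrightarrow> \<omega> \<in> B"
      using Suc[of "s + l s"] by blast
    define B' where "B' = {\<omega>\<in>space ?P. \<omega> \<notin> G s \<and> (left_shift ^^ l s) \<omega> \<in> B}"
    have B' [measurable]: "B' \<in> sets ?P" unfolding B'_def by measurable
    have "measure ?P B' = (\<integral>\<omega>. indicator B' \<omega> \<partial>?P)" by simp
    also have "\<dots> = (\<integral>\<omega>'. (\<integral>\<omega>. indicator B' (comb_seq (l s) \<omega> \<omega>') \<partial>?P) \<partial>?P)"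
      by (rule integral_split[where K=1]) (auto split: split_indicator)
    also have "\<dots> \<le> (\<integral>\<omega>'. (1 - \<delta>) * indicator B \<omega>' \<partial>?P)"
    proof (rule integral_mono)
      show "integrable ?P (\<lambda>\<omega>'. (\<integral>\<omega>. indicator B' (comb_seq (l s) \<omega> \<omega>') \<partial>?P) :: real)"
        by (intro integrable_bounded[where K=1] abs_integral_le) (auto simp: indicator_def)
      show "integrable ?P (\<lambda>\<omega>'. (1 - \<delta>) * indicator B \<omega>' :: real)"
        by (intro integrable_bounded[where K=1]) (use \<delta> \<delta>1 in \<open>auto simp: indicator_def\<close>)
      fix \<omega>'
      have m: "{\<omega>. comb_seq (l s) \<omega> \<omega>' \<in> G s} \<in> sets ?P"
      proof -
        have "{\<omega>\<in>space ?P. comb_seq (l s) \<omega> \<omega>' \<in> G s} \<in> sets ?P" by measurable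
        then show ?thesis by simp
      qed
      have "(\<integral>\<omega>. indicator B' (comb_seq (l s) \<omega> \<omega>') \<partial>?P)
        = (\<integral>\<omega>. indicator B \<omega>' * (1 - indicator {\<omega>. comb_seq (l s) \<omega> \<omega>' \<in> G s} \<omega>) \<partial>?P :: real)"
        by (intro Bochner_Integration.integral_cong) (auto simp: B'_def indicator_def)
      also have "\<dots> = indicator B \<omega>' * (1 - measure ?P {\<omega>. comb_seq (l s) \<omega> \<omega>' \<in> G s})"
      proof -
        have "integrable ?P (indicat_real {\<omega>. comb_seq (l s) \<omega> \<omega>' \<in> G s})"
          by (rule integrable_bounded[where K=1]) (use m in \<open>auto split: split_indicator\<close>)
        then have "(\<integral>\<omega>. 1 - indicat_real {\<omega>. comb_seq (l s) \<omega> \<omega>' \<in> G s} \<omega> \<partial>?P)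
          = 1 - measure ?P {\<omega>. comb_seq (l s) \<omega> \<omega>' \<in> G s}"
          by (subst Bochner_Integration.integral_diff) simp_all
        then show ?thesis by simp
      qed
      also have "\<dots> \<le> indicator B \<omega>' * (1 - \<delta>)"
        using hit[of s \<omega>'] by (intro mult_left_mono) auto
      finally show "(\<integral>\<omega>. indicator B' (comb_seq (l s) \<omega> \<omega>') \<partial>?P) \<le> (1 - \<delta>) * indicator B \<omega>'"
        by (simp add: mult.commute)
    qed
    also have "\<dots> = (1 - \<delta>) * measure ?P B" by simp
    also have "\<dots> \<le> (1 - \<delta>) * (1 - \<delta>) ^ k" using mB \<delta>1 by (intro mult_left_mono) auto
    finally have "measure ?P B' \<le> (1 - \<delta>) ^ Suc k" by simp
    moreover have "\<omega> \<in> B'" if *: "\<forall>j. (left_shift ^^ j) \<omega> \<notin> G (s + j)" for \<omega>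
    proof -
      have "(left_shift ^^ l s) \<omega> \<in> B"
      proof (rule BB, rule allI)
        fix j
        show "(left_shift ^^ j) ((left_shift ^^ l s) \<omega>) \<notin> G (s + l s + j)"
          using *[rule_format, of "l s + j"] by (simp add: left_shift_funpow ac_simps)
      qed
      moreover have "\<omega> \<notin> G s" using *[rule_format, of 0] by simp
      ultimately show ?thesis by (simp add: B'_def)
    qed
    ultimately show ?case using B' by blast
  qed
  define N where "N = {\<omega>\<in>space ?P. \<forall>j. (left_shift ^^ j) \<omega> \<notin> G j}"
  have N [measurable]: "N \<in> sets ?P" unfolding N_def by measurable
  have "measure ?P N \<le> (1 - \<delta>) ^ k" for k
  proof -
    obtain B where "B \<in> sets ?P" "measure ?P B \<le> (1 - \<delta>) ^ k" "N \<subseteq> B"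
      using avoid[of k 0] by (auto simp: N_def)
    then show ?thesis using B.finite_measure_mono[of N B p] by simp
  qed
  moreover have "(\<lambda>k. (1 - \<delta>) ^ k) \<longlonglongrightarrow> 0" using \<delta> \<delta>1 by (intro LIMSEQ_power_zero) auto
  ultimately have "measure ?P N \<le> 0" by (intro LIMSEQ_le_const) auto
  then have "emeasure ?P N = 0" by (simp add: B.emeasure_eq_measure measure_le_0_iff)
  then show ?thesis
    using N by (intro AE_I[of _ _ N]) (auto simp: N_def)
qed

lemma positive_part_le:
  fixes x :: real
  assumes "0 < t" "0 < r"
  shows "(\<bar>x\<bar> + x) / 2 \<le> t + r * x\<^sup>2 + 1 / (4 * r) * indicator {t..} x"
proof (cases "t \<le> x")
  case True
  have "0 \<le> (2 * r * x - 1)\<^sup>2" by simp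
  then have "4 * r * x \<le> 4 * r * (r * x\<^sup>2) + 1" by (simp add: power2_eq_square algebra_simps)
  then have "x \<le> r * x\<^sup>2 + 1 / (4 * r)" using assms by (simp add: field_simps)
  then show ?thesis using True assms by simp
next
  case False
  have "(\<bar>x\<bar> + x) / 2 \<le> t" using False assms by (simp add: abs_if)
  moreover have "0 \<le> r * x\<^sup>2" using assms by simp
  ultimately show ?thesis using False by simp
qed

context reverse_martingale
begin

lemma S_event_sets [measurable]: "A \<in> sets borel \<Longrightarrow> {\<omega>. S n \<omega> \<in> A} \<in> sets P"
proof -
  assume [measurable]: "A \<in> sets borel"
  have "{\<omega>\<in>space P. S n \<omega> \<in> A} \<in> sets P" by measurable
  then show ?thesis by simp
qed

text \<open>If \<open>\<bar>S m\<bar> \<le> c sqrt m\<close> had probability above one half for all large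
  \<open>m\<close>, then the expected time spent in \<open>[-c sqrt n, c sqrt n]\<close> up to
  time \<open>n\<close> would be at least about \<open>n / 2\<close>. By
  \<open>occupation_probability_sum\<close> it is at most of order \<open>c n + sqrt n\<close>, a
  contradiction for small \<open>c\<close>.\<close>

lemma spread_infinitely_often:
  "\<exists>c>0. \<forall>n0. \<exists>m\<ge>n0. 0 < m \<and> measure P {\<omega>. S m \<omega> \<in> {- (c * sqrt m)..c * sqrt m}} \<le> 1 / 2"
proof -
  obtain A N where A: "0 < A" and N: "0 < N" and
    occ: "\<And>M n. 0 \<le> M \<Longrightarrow> (\<Sum>k<n. measure P {\<omega>. S k \<omega> \<in> {-M..M}}) \<le> A * (M + real N * C) * sqrt (real (n + N))"
    using occupation_probability_sum by blast
  define c where "c = 1 / (32 * A)"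
  define K where "K = 2 * A * (real N * C)"
  have c: "0 < c" using A by (simp add: c_def)
  have K: "0 \<le> K" using A C_nonneg by (simp add: K_def)
  have "\<exists>m\<ge>n0. 0 < m \<and> measure P {\<omega>. S m \<omega> \<in> {- (c * sqrt m)..c * sqrt m}} \<le> 1 / 2" for n0
  proof (rule ccontr)
    assume "\<not> ?thesis"
    then have big: "1 / 2 \<le> measure P {\<omega>. S m \<omega> \<in> {- (c * sqrt m)..c * sqrt m}}" if "n0 \<le> m" "0 < m" for m
      using that by (meson le_cases)
    obtain n1 :: nat where n1: "(16 * K)\<^sup>2 < real n1" using reals_Archimedean2 by blast
    define n where "n = n1 + 2 * (n0 + 1) + N"
    have n: "2 * (n0 + 1) \<le> n" "N \<le> n" "0 < n" by (auto simp: n_def)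
    have "(16 * K)\<^sup>2 \<le> real n" using n1 by (simp add: n_def)
    then have K16: "16 * K \<le> sqrt (real n)" by (rule real_le_rsqrt)
    have "real n / 4 \<le> (\<Sum>k\<in>{n0 + 1..<n}. 1 / 2)" using n by (simp add: of_nat_diff)
    also have "\<dots> \<le> (\<Sum>k\<in>{n0 + 1..<n}. measure P {\<omega>. S k \<omega> \<in> {- (c * sqrt n)..c * sqrt n}})"
    proof (rule sum_mono)
      fix k assume k: "k \<in> {n0 + 1..<n}"
      have "c * sqrt k \<le> c * sqrt n" using k c by (intro mult_left_mono) auto
      then have "measure P {\<omega>. S k \<omega> \<in> {- (c * sqrt k)..c * sqrt k}} \<le> measure P {\<omega>. S k \<omega> \<in> {- (c * sqrt n)..c * sqrt n}}"
        by (intro B.finite_measure_mono S_event_sets) auto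
      then show "1 / 2 \<le> measure P {\<omega>. S k \<omega> \<in> {- (c * sqrt n)..c * sqrt n}}"
        using big[of k] k by auto
    qed
    also have "\<dots> \<le> (\<Sum>k<n. measure P {\<omega>. S k \<omega> \<in> {- (c * sqrt n)..c * sqrt n}})"
      by (rule sum_mono2) auto
    also have "\<dots> \<le> A * (c * sqrt n + real N * C) * sqrt (real (n + N))"
      using c by (intro occ) simp
    also have "\<dots> \<le> A * (c * sqrt n + real N * C) * (2 * sqrt n)"
    proof -
      have "sqrt (real (n + N)) \<le> sqrt (4 * real n)" using n by (intro real_sqrt_le_mono) simp
      then show ?thesis using A c C_nonneg by (intro mult_left_mono) (auto simp: real_sqrt_mult)
    qed
    also have "\<dots> = 2 * A * c * (sqrt n * sqrt n) + K * sqrt n" by (simp add: K_def algebra_simps)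
    also have "\<dots> = real n / 16 + K * sqrt n" using A by (simp add: c_def)
    also have "K * sqrt n \<le> sqrt n / 16 * sqrt n" using K16 by (intro mult_right_mono) auto
    also have "sqrt n / 16 * sqrt n = real n / 16" by simp
    finally show False using n by simp
  qed
  then show ?thesis using c by blast
qed

text \<open>Where \<open>\<bar>S m\<bar>\<close> is of order \<open>sqrt m\<close> with probability one half,
  so is the mean of the positive part, because the mean of \<open>S m\<close> is zero; as the
  second moment is of order \<open>m\<close>, this mean cannot come from an event of small
  probability.\<close>

lemma upward_fluctuation:
  "\<exists>c>0. \<exists>\<delta>>0. \<forall>n0. \<exists>m\<ge>n0. \<delta> \<le> measure P {\<omega>. S m \<omega> \<in> {c * sqrt m..}}"
proof -
  obtain c where c: "0 < c" and spread:
    "\<And>n0. \<exists>m\<ge>n0. 0 < m \<and> measure P {\<omega>. S m \<omega> \<in> {- (c * sqrt m)..c * sqrt m}} \<le> 1 / 2"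
    using spread_infinitely_often by blast
  have "c\<^sup>2 / (64 * v) \<le> measure P {\<omega>. S m \<omega> \<in> {c / 8 * sqrt m..}}"
    if m: "0 < m" and sp: "measure P {\<omega>. S m \<omega> \<in> {- (c * sqrt m)..c * sqrt m}} \<le> 1 / 2" for m :: nat
  proof -
    define s where "s = c * sqrt m"
    \<comment> \<open>Chosen such that the quadratic term of \<open>positive_part_le\<close> contributes \<open>s /
      16\<close>, leaving \<open>s / 16\<close> for the event.\<close>
    define r where "r = c / (16 * v * sqrt m)"
    define q where "q = measure P {\<omega>. S m \<omega> \<in> {c / 8 * sqrt m..}}"
    have s: "0 < s" and r: "0 < r" using c m v_pos by (simp_all add: s_def r_def)
    have ind: "(\<integral>\<omega>. indicator A (S m \<omega>) \<partial>P) = measure P {\<omega>. S m \<omega> \<in> A}" if "A \<in> sets borel" for A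
    proof -
      have "(\<integral>\<omega>. indicator A (S m \<omega>) \<partial>P) = (\<integral>\<omega>. indicator {\<omega>. S m \<omega> \<in> A} \<omega> \<partial>P :: real)"
        by (intro Bochner_Integration.integral_cong) (auto simp: indicator_def)
      then show ?thesis using that by simp
    qed
    have indi: "integrable P (\<lambda>\<omega>. indicator A (S m \<omega>) :: real)" if [measurable]: "A \<in> sets borel" for A
      by (intro integrable_bounded[where K=1]) (auto split: split_indicator)
    have "s * (1 / 2) \<le> s * (1 - measure P {\<omega>. S m \<omega> \<in> {-s..s}})"
      using s sp unfolding s_def by (intro mult_left_mono) linarith+
    also have "\<dots> = (\<integral>\<omega>. s * (1 - indicator {-s..s} (S m \<omega>)) \<partial>P)"
      using indi by (simp add: ind)
    also have "\<dots> \<le> (\<integral>\<omega>. \<bar>S m \<omega>\<bar> \<partial>P)"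
      using s indi by (intro integral_mono) (auto split: split_indicator)
    finally have "s / 4 \<le> (\<integral>\<omega>. (\<bar>S m \<omega>\<bar> + S m \<omega>) / 2 \<partial>P)"
      by (simp add: mean_S)
    also have "\<dots> \<le> (\<integral>\<omega>. s / 8 + r * (S m \<omega>)\<^sup>2 + 1 / (4 * r) * indicator {s / 8..} (S m \<omega>) \<partial>P)"
      using positive_part_le[of "s / 8" r] s r indi by (intro integral_mono) auto
    also have "\<dots> = s / 8 + r * (real m * v) + 1 / (4 * r) * q"
      using indi by (simp add: ind second_moment q_def s_def)
    also have "r * (real m * v) = s / 16"
    proof -
      have "r * (real m * v) = r * (sqrt m * sqrt m * v)" by simp
      also have "\<dots> = r * v * sqrt m * sqrt m" by (simp only: mult_ac)
      also have "r * v * sqrt m = c / 16" using m v_pos by (simp add: r_def)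
      finally show ?thesis by (simp add: s_def)
    qed
    finally have "s / 16 \<le> q / (4 * r)" by simp
    then have "s * r / 4 \<le> q" using r by (simp add: field_simps)
    moreover have "s * r / 4 = c\<^sup>2 / (64 * v)" using m v_pos by (simp add: s_def r_def power2_eq_square)
    ultimately show ?thesis by (simp add: q_def)
  qed
  then show ?thesis using spread c v_pos
    by (intro exI[of _ "c / 8"] conjI exI[of _ "c\<^sup>2 / (64 * v)"]) (auto, meson)
qed

text \<open>\<open>N\<close> independent upward fluctuations in a row; each concatenation costs at most the
  distortion. This reaches height of order \<open>N sqrt m = sqrt N * sqrt (N m)\<close>, an
  arbitrarily large multiple of the typical fluctuation at time \<open>N m\<close>, with a
  probability that does not depend on \<open>m\<close>.\<close>

lemma block_power:
  assumes "\<delta> \<le> measure P {\<omega>. S m \<omega> \<in> {t..}}" "0 \<le> \<delta>"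
  shows "\<delta> ^ N \<le> measure P {\<omega>. S (N * m) \<omega> \<in> {real N * (t - D)..}}"
proof (induction N)
  case 0
  then show ?case by simp
next
  case (Suc N)
  have "\<delta> ^ Suc N \<le> measure P {\<omega>. S m \<omega> \<in> {t..}} * measure P {\<omega>. S (N * m) \<omega> \<in> {real N * (t - D)..}}"
    unfolding power_Suc using assms Suc by (intro mult_mono) auto
  also have "\<dots> \<le> measure P {\<omega>. S (m + N * m) \<omega> \<in> {real (Suc N) * (t - D)..}}"
  proof (rule prob_ge_product[where n=m])
    fix \<omega> \<omega>' assume "\<omega> \<in> {\<omega>. S m \<omega> \<in> {t..}}" "\<omega>' \<in> {\<omega>. S (N * m) \<omega> \<in> {real N * (t - D)..}}"
    then show "comb_seq m \<omega> \<omega>' \<in> {\<omega>. S (m + N * m) \<omega> \<in> {real (Suc N) * (t - D)..}}"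
      using S_comb_near[of m m \<omega> \<omega>'] by (simp add: S_comb algebra_simps)
  qed measurable
  finally show ?case by simp
qed

text \<open>Chebyshev's inequality at every time and then Markov's inequality for the occupation time. The
  fraction of time below \<open>-h\<close>, rather than the minimum of the walk, is what enters
  the time averages.\<close>

lemma rarely_far_below:
  assumes h: "0 < h" "2 * real Q * v \<le> \<epsilon> * h\<^sup>2" and \<epsilon>: "0 < \<epsilon>" and Q: "0 < Q"
  shows "1 / 2 \<le> measure P {\<omega>. occupation (\<lambda>j. S j \<omega>) {..-h} Q \<le> \<epsilon> * Q}"
proof -
  let ?o = "\<lambda>\<omega>. occupation (\<lambda>j. S j \<omega>) {..-h} Q"
  have m: "{\<omega>. ?o \<omega> \<le> \<epsilon> * Q} \<in> sets P" "{\<omega>. \<not> ?o \<omega> \<le> \<epsilon> * Q} \<in> sets P"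
  proof -
    have "{\<omega>\<in>space P. ?o \<omega> \<le> \<epsilon> * Q} \<in> sets P" "{\<omega>\<in>space P. \<not> ?o \<omega> \<le> \<epsilon> * Q} \<in> sets P" by measurable
    then show "{\<omega>. ?o \<omega> \<le> \<epsilon> * Q} \<in> sets P" "{\<omega>. \<not> ?o \<omega> \<le> \<epsilon> * Q} \<in> sets P" by simp_all
  qed
  have oi: "integrable P ?o"
    by (rule integrable_bounded[where K="real Q"]) (auto simp: occupation_le)
  have "\<epsilon> * Q * measure P {\<omega>. \<not> ?o \<omega> \<le> \<epsilon> * Q} = (\<integral>\<omega>. \<epsilon> * Q * indicator {\<omega>. \<not> ?o \<omega> \<le> \<epsilon> * Q} \<omega> \<partial>P)"
    using m by simp
  also have "\<dots> \<le> (\<integral>\<omega>. ?o \<omega> \<partial>P)"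
  proof (rule integral_mono)
    have "integrable P (indicat_real {\<omega>. \<not> ?o \<omega> \<le> \<epsilon> * Q})"
      by (rule integrable_bounded[where K=1]) (use m in \<open>auto split: split_indicator\<close>)
    then show "integrable P (\<lambda>\<omega>. \<epsilon> * Q * indicat_real {\<omega>. \<not> ?o \<omega> \<le> \<epsilon> * Q} \<omega>)"
      by simp
  qed (use oi in \<open>auto split: split_indicator\<close>)
  also have "\<dots> = (\<Sum>k<Q. measure P {\<omega>. S k \<omega> \<in> {..-h}})" by (rule integral_occupation) simp
  also have "\<dots> \<le> (\<Sum>k<Q. real Q * v / h\<^sup>2)"
  proof (rule sum_mono)
    fix k assume k: "k \<in> {..<Q}"
    have "measure P {\<omega>. S k \<omega> \<in> {..-h}} = (\<integral>\<omega>. indicator {\<omega>. S k \<omega> \<in> {..-h}} \<omega> \<partial>P)" by simp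
    also have "\<dots> \<le> (\<integral>\<omega>. (S k \<omega>)\<^sup>2 / h\<^sup>2 \<partial>P)"
    proof (rule integral_mono)
      fix \<omega>
      have "h\<^sup>2 \<le> (S k \<omega>)\<^sup>2" if "S k \<omega> \<le> -h"
        using that h abs_le_square_iff[of h "S k \<omega>"] by simp
      then show "indicator {\<omega>. S k \<omega> \<in> {..-h}} \<omega> \<le> (S k \<omega>)\<^sup>2 / h\<^sup>2"
        using h by (auto simp: indicator_def)
    next
      show "integrable P (indicat_real {\<omega>. S k \<omega> \<in> {..-h}})"
        by (intro integrable_bounded[where K=1]) (auto split: split_indicator)
    qed simp
    also have "\<dots> = real k * v / h\<^sup>2" by (simp add: second_moment)
    also have "\<dots> \<le> real Q * v / h\<^sup>2" using k v_pos by (intro divide_right_mono mult_right_mono) auto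
    finally show "measure P {\<omega>. S k \<omega> \<in> {..-h}} \<le> real Q * v / h\<^sup>2" .
  qed
  also have "\<dots> \<le> Q * (\<epsilon> / 2)"
  proof -
    have "real Q * v / h\<^sup>2 \<le> \<epsilon> / 2" using h by (simp add: field_simps)
    then have "real Q * (real Q * v / h\<^sup>2) \<le> real Q * (\<epsilon> / 2)" by (intro mult_left_mono) auto
    then show ?thesis by simp
  qed
  finally have "measure P {\<omega>. \<not> ?o \<omega> \<le> \<epsilon> * Q} \<le> 1 / 2"
    using \<epsilon> Q by (simp add: field_simps)
  moreover have "measure P {\<omega>. \<not> ?o \<omega> \<le> \<epsilon> * Q} = 1 - measure P {\<omega>. ?o \<omega> \<le> \<epsilon> * Q}"
    using B.prob_compl[OF m(1)] by (simp add: set_diff_eq)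
  ultimately show ?thesis by simp
qed

text \<open>First the walk climbs, by \<open>block_power\<close>, to a height that exceeds the typical
  fluctuation over the next \<open>Q\<close> steps; then by \<open>rarely_far_below\<close> it
  spends most of these steps above \<open>R\<close>. As \<open>Q\<close> is a large multiple of
  the climbing time, this is most of the total time. For the repeated attempts below it matters
  that \<open>\<delta>\<close> depends neither on the level \<open>R\<close> nor on the length of
  the attempt.\<close>

lemma high_fraction_probability:
  assumes \<epsilon>: "0 < \<epsilon>" "\<epsilon> < 1"
  shows "\<exists>\<delta>>0. \<forall>R n0. \<exists>l\<ge>n0. \<delta> \<le> measure P {\<omega>. (1 - \<epsilon>) * real l \<le> occupation (\<lambda>j. S j \<omega>) {R<..} l}"
proof -
  obtain c \<delta>0 where c: "0 < c" and \<delta>0: "0 < \<delta>0"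
    and up: "\<And>n0. \<exists>m\<ge>n0. \<delta>0 \<le> measure P {\<omega>. S m \<omega> \<in> {c * sqrt m..}}"
    using upward_fluctuation by blast
  \<comment> \<open>The climb takes \<open>N m\<close> steps and is followed by \<open>Q = L N m\<close> steps;
    \<open>\<kappa> sqrt (N m)\<close> is the fluctuation to be allowed for in these.\<close>
  obtain L :: nat where L: "2 / \<epsilon> < real L" using reals_Archimedean2 by blast
  then have L\<epsilon>: "2 \<le> \<epsilon> * real L" and L0: "0 < L" using \<epsilon> by (auto simp: field_simps intro: gr0I)
  define \<kappa> where "\<kappa> = sqrt (4 * real L * v / \<epsilon>)"
  have \<kappa>: "0 < \<kappa>" "\<kappa>\<^sup>2 = 4 * real L * v / \<epsilon>" using L0 v_pos \<epsilon> by (simp_all add: \<kappa>_def)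
  obtain N :: nat where N': "((\<kappa> + 1) / c)\<^sup>2 < real N" using reals_Archimedean2 by blast
  then have N0: "0 < N" by (auto intro: gr0I simp: not_less)
  have "(\<kappa> + 1) / c \<le> sqrt N" using N' by (intro real_le_rsqrt) simp
  then have Nc: "\<kappa> + 1 \<le> sqrt N * c" using c by (simp add: field_simps)
  \<comment> \<open>The climb \<open>N c sqrt m\<close> beats the fluctuation by at least \<open>sqrt m\<close>, which
    absorbs all bounded errors.\<close>
  have gain: "1 \<le> real N * c - sqrt N * \<kappa>"
  proof -
    have "1 * 1 \<le> sqrt N * (sqrt N * c - \<kappa>)" using Nc N0 by (intro mult_mono) auto
    then show ?thesis by (simp add: algebra_simps flip: mult.assoc)
  qed
  have "\<exists>l\<ge>n0. \<delta>0 ^ N / 2 \<le> measure P {\<omega>. (1 - \<epsilon>) * real l \<le> occupation (\<lambda>j. S j \<omega>) {R<..} l}" for R n0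
  proof -
    define T where "T = R + real N * D + D"
    obtain m0 :: nat where m0: "T\<^sup>2 < real m0" using reals_Archimedean2 by blast
    obtain m where m: "m \<ge> m0 + n0 + 1" and upm: "\<delta>0 \<le> measure P {\<omega>. S m \<omega> \<in> {c * sqrt m..}}"
      using up by blast
    have "T \<le> sqrt m" using m m0 by (intro real_le_rsqrt) simp
    define Q where "Q = L * N * m"
    define h where "h = sqrt m * sqrt N * \<kappa>"
    define l where "l = N * m + Q"
    have h: "0 < h" using m N0 \<kappa> by (simp add: h_def)
    have Q: "0 < Q" using m N0 L0 by (simp add: Q_def)
    have h2: "2 * real Q * v \<le> \<epsilon> / 2 * h\<^sup>2"
      using \<epsilon> by (simp add: h_def power_mult_distrib \<kappa> Q_def)
    have enough: "R \<le> real N * (c * sqrt m - D) - D - h"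
    proof -
      have "sqrt m * 1 \<le> sqrt m * (real N * c - sqrt N * \<kappa>)" using gain by (intro mult_left_mono) auto
      then have "T \<le> real N * c * sqrt m - h" using \<open>T \<le> sqrt m\<close> by (simp add: h_def algebra_simps)
      then show ?thesis by (simp add: T_def algebra_simps)
    qed
    let ?E = "{\<omega>. S (N * m) \<omega> \<in> {real N * (c * sqrt m - D)..}}"
    let ?F = "{\<omega>. occupation (\<lambda>j. S j \<omega>) {..-h} Q \<le> \<epsilon> / 2 * Q}"
    let ?G = "{\<omega>. (1 - \<epsilon>) * real l \<le> occupation (\<lambda>j. S j \<omega>) {R<..} l}"
    have "\<delta>0 ^ N * (1 / 2) \<le> measure P ?E * measure P ?F"
      using block_power[OF upm, of N] rarely_far_below[OF h h2 _ Q] \<delta>0 \<epsilon> by (intro mult_mono) auto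
    also have "\<dots> \<le> measure P ?G"
    proof (rule prob_ge_product[where n="N * m"])
      fix \<omega> \<omega>' assume E: "\<omega> \<in> ?E" and F: "\<omega>' \<in> ?F"
      let ?z = "comb_seq (N * m) \<omega> \<omega>'"
      have "real Q - occupation (\<lambda>j. S j \<omega>') {..-h} Q = occupation (\<lambda>j. S j \<omega>') {-h<..} Q"
      proof -
        have "occupation (\<lambda>j. S j \<omega>') {..-h} Q + occupation (\<lambda>j. S j \<omega>') {-h<..} Q = (\<Sum>j<Q. 1)"
          unfolding occupation_def sum.distrib[symmetric] by (intro sum.cong) (auto simp: indicator_def)
        then show ?thesis by simp
      qed
      also have "\<dots> \<le> occupation (\<lambda>j. S (N * m + j) ?z) {R<..} Q"
      proof (rule occupation_mono)
        fix j assume "S j \<omega>' \<in> {-h<..}"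
        then show "S (N * m + j) ?z \<in> {R<..}"
          using S_comb_near[of "N * m" "N * m" \<omega> \<omega>'] E enough by (simp add: S_comb)
      qed
      also have "\<dots> \<le> occupation (\<lambda>j. S j ?z) {R<..} l"
        by (simp add: l_def occupation_add)
      finally have "(1 - \<epsilon> / 2) * real Q \<le> occupation (\<lambda>j. S j ?z) {R<..} l"
        using F by (simp add: algebra_simps)
      moreover have "(1 - \<epsilon>) * real l \<le> (1 - \<epsilon> / 2) * real Q"
      proof -
        have "(1 - \<epsilon>) * (1 + real L) \<le> (1 - \<epsilon> / 2) * real L" using L\<epsilon> \<epsilon> by (simp add: algebra_simps)
        then have "(1 - \<epsilon>) * (1 + real L) * real (N * m) \<le> (1 - \<epsilon> / 2) * real L * real (N * m)"
          by (intro mult_right_mono) auto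
        then show ?thesis by (simp add: l_def Q_def algebra_simps)
      qed
      ultimately show "?z \<in> ?G" by simp
    next
      have "{\<omega>\<in>space P. occupation (\<lambda>j. S j \<omega>) {..-h} Q \<le> \<epsilon> / 2 * Q} \<in> sets P" by measurable
      then show "?F \<in> sets P" by simp
      have "{\<omega>\<in>space P. (1 - \<epsilon>) * real l \<le> occupation (\<lambda>j. S j \<omega>) {R<..} l} \<in> sets P" by measurable
      then show "?G \<in> sets P" by simp
    qed measurable
    finally have "\<delta>0 ^ N / 2 \<le> measure P ?G" by simp
    moreover have "n0 \<le> l"
    proof -
      have "n0 \<le> m" using m by simp
      also have "m \<le> N * m" using N0 by simp
      finally show ?thesis by (simp add: l_def)
    qed
    ultimately show ?thesis by blast
  qed
  then show ?thesis using \<delta>0 by (intro exI[of _ "\<delta>0 ^ N / 2"]) auto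
qed

text \<open>Attempts as in \<open>high_fraction_probability\<close> are repeated by
  \<open>AE_shifted_hit\<close>. An attempt started at time \<open>s\<close> has to last much
  longer than \<open>s\<close>, so that the time before it does not spoil the fraction, and it has
  to rise by \<open>s * C\<close> more, which is the most that the walk can have lost up to then.\<close>

lemma AE_high_fraction_once:
  assumes \<epsilon>: "0 < \<epsilon>" "\<epsilon> < 1"
  shows "AE \<omega> in P. \<exists>n\<ge>n0. 0 < n \<and> (1 - \<epsilon>) * real n \<le> occupation (\<lambda>j. S j \<omega>) {R<..} n"
proof -
  have "0 < \<epsilon> / 2" "\<epsilon> / 2 < 1" using \<epsilon> by auto
  from high_fraction_probability[OF this] obtain \<delta> where \<delta>: "0 < \<delta>" and
    "\<forall>R n0. \<exists>l\<ge>n0. \<delta> \<le> measure P {\<omega>. (1 - \<epsilon> / 2) * real l \<le> occupation (\<lambda>j. S j \<omega>) {R<..} l}"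
    by blast
  then have "\<forall>s. \<exists>l. n0 + 1 + nat \<lceil>2 * real s / \<epsilon>\<rceil> \<le> l \<and>
      \<delta> \<le> measure P {\<omega>. (1 - \<epsilon> / 2) * real l \<le> occupation (\<lambda>j. S j \<omega>) {R + real s * C + D<..} l}"
    by blast
  then obtain l where l: "\<And>s. n0 + 1 + nat \<lceil>2 * real s / \<epsilon>\<rceil> \<le> l s" and
    pr: "\<And>s. \<delta> \<le> measure P {\<omega>. (1 - \<epsilon> / 2) * real (l s) \<le> occupation (\<lambda>j. S j \<omega>) {R + real s * C + D<..} (l s)}"
    by metis
  define G where "G = (\<lambda>s. {\<omega>\<in>space P. (1 - \<epsilon> / 2) * real (l s) \<le> occupation (\<lambda>j. S j \<omega>) {R + real s * C<..} (l s)})"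
  have G: "G s \<in> sets P" for s unfolding G_def by measurable
  have "AE \<omega> in P. \<exists>s. (left_shift ^^ s) \<omega> \<in> G s"
  proof (rule AE_shifted_hit[OF \<delta> G])
    fix s \<omega>'
    note pr[of s]
    also have "measure P {\<omega>. (1 - \<epsilon> / 2) * real (l s) \<le> occupation (\<lambda>j. S j \<omega>) {R + real s * C + D<..} (l s)}
      \<le> measure P {\<omega>. comb_seq (l s) \<omega> \<omega>' \<in> G s}"
    proof (rule B.finite_measure_mono)
      note [measurable] = G
      have "{\<omega>\<in>space P. comb_seq (l s) \<omega> \<omega>' \<in> G s} \<in> sets P" by measurable
      then show "{\<omega>. comb_seq (l s) \<omega> \<omega>' \<in> G s} \<in> sets P" by simp
      have "occupation (\<lambda>j. S j \<omega>) {R + real s * C + D<..} (l s)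
          \<le> occupation (\<lambda>j. S j (comb_seq (l s) \<omega> \<omega>')) {R + real s * C<..} (l s)" for \<omega>
      proof (rule occupation_mono)
        fix j assume "j < l s" "S j \<omega> \<in> {R + real s * C + D<..}"
        then show "S j (comb_seq (l s) \<omega> \<omega>') \<in> {R + real s * C<..}"
          using S_comb_near[of j "l s" \<omega> \<omega>'] by simp
      qed
      then show "{\<omega>. (1 - \<epsilon> / 2) * real (l s) \<le> occupation (\<lambda>j. S j \<omega>) {R + real s * C + D<..} (l s)}
        \<subseteq> {\<omega>. comb_seq (l s) \<omega> \<omega>' \<in> G s}"
        by (auto simp: G_def intro: order_trans)
    qed
    finally show "\<delta> \<le> measure P {\<omega>. comb_seq (l s) \<omega> \<omega>' \<in> G s}" .
  qed
  then show ?thesis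
  proof eventually_elim
    case (elim \<omega>)
    then obtain s where s: "(left_shift ^^ s) \<omega> \<in> G s" by blast
    have "(1 - \<epsilon> / 2) * real (l s) \<le> occupation (\<lambda>j. S j ((left_shift ^^ s) \<omega>)) {R + real s * C<..} (l s)"
      using s by (simp add: G_def)
    also have "\<dots> \<le> occupation (\<lambda>j. S (s + j) \<omega>) {R<..} (l s)"
    proof (rule occupation_mono)
      fix j assume "S j ((left_shift ^^ s) \<omega>) \<in> {R + real s * C<..}"
      then show "S (s + j) \<omega> \<in> {R<..}"
        using S_bounded[of s \<omega>] by (simp add: birkhoff_add)
    qed
    also have "\<dots> \<le> occupation (\<lambda>j. S j \<omega>) {R<..} (s + l s)"
      by (simp add: occupation_add)
    finally have "(1 - \<epsilon> / 2) * real (l s) \<le> occupation (\<lambda>j. S j \<omega>) {R<..} (s + l s)" .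
    moreover have "(1 - \<epsilon>) * real (s + l s) \<le> (1 - \<epsilon> / 2) * real (l s)"
    proof -
      have "2 * real s / \<epsilon> \<le> real (l s)" using l[of s] by linarith
      then have "real s \<le> \<epsilon> / 2 * real (l s)" using \<epsilon> by (simp add: field_simps)
      moreover have "(1 - \<epsilon>) * real s \<le> 1 * real s" using \<epsilon> by (intro mult_right_mono) auto
      ultimately show ?thesis by (simp add: algebra_simps)
    qed
    ultimately show ?case using l[of s] by (intro exI[of _ "s + l s"]) auto
  qed
qed

lemma AE_high_fraction:
  "AE \<omega> in P. \<forall>k R n0::nat. \<exists>n\<ge>n0. 0 < n \<and>
     (1 - 1 / real (k + 2)) * real n \<le> occupation (\<lambda>j. S j \<omega>) {real R<..} n"
  by (intro AE_all_countable[THEN iffD2] allI AE_high_fraction_once) auto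

end

section \<open>Empirical measures of oscillating walks on the interval\<close>

text \<open>The properties of the logit of a typical orbit: it spends a fraction of time tending to zero at
  bounded heights, and up to suitable times almost all of its past is above, respectively below,
  any given level. Tolerances run through \<open>1 / (k + 2)\<close> and levels through the
  natural numbers, so that the property is a countable intersection of almost sure events.\<close>

definition oscillating :: "(nat \<Rightarrow> real) \<Rightarrow> bool" where
  "oscillating y \<longleftrightarrow>
     (\<forall>M::nat. (\<lambda>n. occupation y {- real M..real M} n / real n) \<longlonglongrightarrow> 0) \<and>
     (\<forall>k R n0::nat. \<exists>n\<ge>n0. 0 < n \<and> (1 - 1 / real (k + 2)) * real n \<le> occupation y {real R<..} n) \<and>
     (\<forall>k R n0::nat. \<exists>n\<ge>n0. 0 < n \<and> (1 - 1 / real (k + 2)) * real n \<le> occupation y {..<- real R} n)"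

text \<open>All levels are treated alike, so the property does not notice bounded changes of the sequence.
  This makes it possible to pass from the reverse martingale to the cocycle, and from the cocycle
  to the logit of an orbit with arbitrary starting point.\<close>

lemma oscillating_perturb:
  assumes y: "oscillating y" and near: "\<And>j. \<bar>z j - y j\<bar> \<le> K"
  shows "oscillating z"
proof -
  obtain L :: nat where L: "K \<le> real L" using real_arch_simple by blast
  have near': "\<bar>z j - y j\<bar> \<le> real L" for j using near[of j] L by linarith
  have 1: "(\<lambda>n. occupation z {- real M..real M} n / real n) \<longlonglongrightarrow> 0" for M :: nat
  proof (rule tendsto_sandwich[OF _ _ tendsto_const])
    show "(\<lambda>n. occupation y {- real (M + L)..real (M + L)} n / real n) \<longlonglongrightarrow> 0"
      using y by (simp only: oscillating_def)
    have "occupation z {- real M..real M} n \<le> occupation y {- real (M + L)..real (M + L)} n" for n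
    proof (rule occupation_mono)
      fix j assume "z j \<in> {- real M..real M}"
      then show "y j \<in> {- real (M + L)..real (M + L)}" using near'[of j] by simp linarith
    qed
    then show "\<forall>\<^sub>F n in sequentially. occupation z {- real M..real M} n / real n \<le> occupation y {- real (M + L)..real (M + L)} n / real n"
      by (intro always_eventually allI divide_right_mono) auto
  qed auto
  have 2: "\<exists>n\<ge>n0. 0 < n \<and> (1 - 1 / real (k + 2)) * real n \<le> occupation z {real R<..} n" for k R n0 :: nat
  proof -
    obtain n where "n \<ge> n0" "0 < n" and n: "(1 - 1 / real (k + 2)) * real n \<le> occupation y {real (R + L)<..} n"
      using y unfolding oscillating_def by blast
    note n
    also have "occupation y {real (R + L)<..} n \<le> occupation z {real R<..} n"
    proof (rule occupation_mono)
      fix j assume "y j \<in> {real (R + L)<..}"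
      then show "z j \<in> {real R<..}" using near'[of j] by simp
    qed
    finally show ?thesis using \<open>n \<ge> n0\<close> \<open>0 < n\<close> by blast
  qed
  have 3: "\<exists>n\<ge>n0. 0 < n \<and> (1 - 1 / real (k + 2)) * real n \<le> occupation z {..<- real R} n" for k R n0 :: nat
  proof -
    obtain n where "n \<ge> n0" "0 < n" and n: "(1 - 1 / real (k + 2)) * real n \<le> occupation y {..<- real (R + L)} n"
      using y unfolding oscillating_def by blast
    note n
    also have "occupation y {..<- real (R + L)} n \<le> occupation z {..<- real R} n"
    proof (rule occupation_mono)
      fix j assume "y j \<in> {..<- real (R + L)}"
      then show "z j \<in> {..<- real R}" using near'[of j] by simp
    qed
    finally show ?thesis using \<open>n \<ge> n0\<close> \<open>0 < n\<close> by blast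
  qed
  show ?thesis unfolding oscillating_def using 1 2 3 by blast
qed

text \<open>The weight that the empirical measure puts near \<open>0\<close> once time spent at bounded
  heights is neglected.\<close>

definition low_fraction :: "(nat \<Rightarrow> real) \<Rightarrow> nat \<Rightarrow> real" where
  "low_fraction y n = occupation y {..0} n / real n"

lemma low_fraction_Suc:
  assumes "0 < n"
  shows "low_fraction y (Suc n) \<le> low_fraction y n + 1 / real (Suc n)"
proof -
  have "occupation y {..0} (Suc n) \<le> occupation y {..0} n + 1"
    by (simp add: occupation_def indicator_def)
  then have "low_fraction y (Suc n) \<le> (occupation y {..0} n + 1) / real (Suc n)"
    unfolding low_fraction_def by (intro divide_right_mono) auto
  also have "\<dots> \<le> occupation y {..0} n / real n + 1 / real (Suc n)"
    unfolding add_divide_distrib using assms by (intro add_mono divide_left_mono) auto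
  finally show ?thesis by (simp add: low_fraction_def)
qed

text \<open>The fraction comes arbitrarily close to both \<open>0\<close> and \<open>1\<close>, and its
  increments tend to zero, so by a discrete intermediate value argument it comes close to every
  number in between.\<close>

lemma low_fraction_approximates:
  assumes y: "oscillating y" and t: "0 \<le> t" "t \<le> 1" and e: "0 < e"
  shows "\<exists>n\<ge>n0. 0 < n \<and> \<bar>low_fraction y n - t\<bar> < e"
proof -
  obtain k :: nat where k: "2 / e < real k" using reals_Archimedean2 by blast
  have k2: "1 / real (k + 2) < e"
  proof -
    have "2 < e * real k" using k e by (simp add: field_simps)
    then have "1 < e * real (k + 2)" using e by (simp add: algebra_simps)
    then show ?thesis by (simp add: field_simps)
  qed
  define m where "m = max n0 (k + 2)"
  obtain n1 where n1: "n1 \<ge> m" "0 < n1" "(1 - 1 / real (k + 2)) * real n1 \<le> occupation y {real 0<..} n1"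
    using y unfolding oscillating_def by blast
  obtain n2 where n2: "n2 \<ge> n1" "0 < n2" "(1 - 1 / real (k + 2)) * real n2 \<le> occupation y {..<- real 0} n2"
    using y unfolding oscillating_def by blast
  have "occupation y {..0} n1 + occupation y {real 0<..} n1 = (\<Sum>j<n1. 1)"
    unfolding occupation_def sum.distrib[symmetric] by (intro sum.cong) (auto simp: indicator_def)
  then have "occupation y {..0} n1 \<le> 1 / real (k + 2) * real n1" using n1(3) by (simp add: algebra_simps)
  then have low: "low_fraction y n1 \<le> 1 / real (k + 2)"
    using n1 by (simp add: low_fraction_def pos_divide_le_eq)
  have "occupation y {..<- real 0} n2 \<le> occupation y {..0} n2" by (rule occupation_mono) auto
  then have high: "1 - 1 / real (k + 2) \<le> low_fraction y n2"
    using n2 by (simp add: low_fraction_def pos_le_divide_eq)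
  consider "t \<le> low_fraction y n1" | "low_fraction y n2 < t"
    | "low_fraction y n1 < t" "t \<le> low_fraction y n2" by linarith
  then show ?thesis
  proof cases
    case 1
    then show ?thesis using low k2 t n1
      by (intro exI[of _ n1]) (auto simp: m_def)
  next
    case 2
    then show ?thesis using high k2 t n1 n2
      by (intro exI[of _ n2]) (auto simp: m_def)
  next
    case 3
    define n where "n = (LEAST n. n1 \<le> n \<and> t \<le> low_fraction y n)"
    have n: "n1 \<le> n" "t \<le> low_fraction y n"
      using LeastI[of "\<lambda>n. n1 \<le> n \<and> t \<le> low_fraction y n" n2] 3 n2 by (auto simp: n_def)
    then have "n \<noteq> n1" using 3 by auto
    then obtain q where q: "n = Suc q" "n1 \<le> q" using n(1) by (cases n) auto
    have "\<not> t \<le> low_fraction y q"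
      using not_less_Least[of q "\<lambda>n. n1 \<le> n \<and> t \<le> low_fraction y n"] q by (simp add: n_def)
    moreover have "low_fraction y n \<le> low_fraction y q + 1 / real n"
      unfolding q(1) using q n1 by (intro low_fraction_Suc) simp
    moreover have "1 / real n \<le> 1 / real (k + 2)"
      using n n1 by (intro divide_left_mono) (auto simp: m_def)
    ultimately show ?thesis using n k2 n1 by (intro exI[of _ n]) (auto simp: m_def)
  qed
qed

definition logistic :: "real \<Rightarrow> real" where
  "logistic z = exp z / (1 + exp z)"

lemma logistic_bounds: "0 < logistic z" "logistic z < 1"
  by (auto simp: logistic_def add_pos_pos divide_less_eq_1)

lemma logistic_at_top: "(logistic \<longlongrightarrow> 1) at_top"
  unfolding logistic_def by real_asymp

lemma logistic_at_bot: "(logistic \<longlongrightarrow> 0) at_bot"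
  unfolding logistic_def by real_asymp

lemma continuous_at_ends:
  fixes \<phi> :: "real \<Rightarrow> real"
  assumes \<phi>: "continuous_on {0..1} \<phi>"
  shows "((\<lambda>z. \<phi> (logistic z)) \<longlongrightarrow> \<phi> 1) at_top" "((\<lambda>z. \<phi> (logistic z)) \<longlongrightarrow> \<phi> 0) at_bot"
proof -
  have mem: "\<forall>\<^sub>F z in F. logistic z \<in> {0..1}" for F
    using logistic_bounds by (auto intro!: always_eventually less_imp_le)
  show "((\<lambda>z. \<phi> (logistic z)) \<longlongrightarrow> \<phi> 1) at_top" "((\<lambda>z. \<phi> (logistic z)) \<longlongrightarrow> \<phi> 0) at_bot"
    using continuous_on_tendsto_compose[OF \<phi> logistic_at_top _ mem]
      continuous_on_tendsto_compose[OF \<phi> logistic_at_bot _ mem] by auto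
qed

text \<open>Outside of a bounded range of heights, \<open>\<phi> (logistic z)\<close> is close to
  \<open>\<phi> 0\<close> or \<open>\<phi> 1\<close> according to the sign of \<open>z\<close>,
  and the time spent in the bounded range has density zero.\<close>

lemma average_minus_mixture:
  fixes \<phi> :: "real \<Rightarrow> real"
  assumes y: "oscillating y" and \<phi>: "continuous_on {0..1} \<phi>"
  shows "(\<lambda>n. (1 / real n) * (\<Sum>j<n. \<phi> (logistic (y j)))
      - (low_fraction y n * \<phi> 0 + (1 - low_fraction y n) * \<phi> 1)) \<longlonglongrightarrow> 0" (is "?d \<longlonglongrightarrow> 0")
proof (rule LIMSEQ_I)
  fix e :: real assume e: "0 < e"
  have "compact (\<phi> ` {0..1})" using \<phi> by (intro compact_continuous_image) auto
  then obtain B where B: "\<And>x. x \<in> {0..1} \<Longrightarrow> \<bar>\<phi> x\<bar> \<le> B"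
    using compact_imp_bounded bounded_real by (metis imageI)
  have B0: "0 \<le> B" using B[of 0] by simp
  have "\<forall>\<^sub>F z in at_top. dist (\<phi> (logistic z)) (\<phi> 1) < e / 2"
    using continuous_at_ends(1)[OF \<phi>] e by (intro tendstoD) auto
  then obtain M1 where M1: "\<And>z. M1 \<le> z \<Longrightarrow> \<bar>\<phi> (logistic z) - \<phi> 1\<bar> < e / 2"
    by (auto simp: eventually_at_top_linorder dist_real_def)
  have "\<forall>\<^sub>F z in at_bot. dist (\<phi> (logistic z)) (\<phi> 0) < e / 2"
    using continuous_at_ends(2)[OF \<phi>] e by (intro tendstoD) auto
  then obtain M0 where M0: "\<And>z. z \<le> M0 \<Longrightarrow> \<bar>\<phi> (logistic z) - \<phi> 0\<bar> < e / 2"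
    by (auto simp: eventually_at_bot_linorder dist_real_def)
  obtain M :: nat where M: "max M1 (- M0) \<le> real M" using real_arch_simple by blast
  define w where "w = (\<lambda>z::real. indicator {..0} z * \<phi> 0 + (1 - indicator {..0} z) * \<phi> 1 :: real)"
  have pointwise: "\<bar>\<phi> (logistic z) - w z\<bar> \<le> e / 2 + 2 * B * indicator {- real M..real M} z" for z
  proof (cases "z \<in> {- real M..real M}")
    case True
    have "\<bar>\<phi> (logistic z)\<bar> \<le> B" using logistic_bounds[of z] by (intro B) auto
    moreover have "\<bar>w z\<bar> \<le> B" using B[of 0] B[of 1] by (simp add: w_def indicator_def)
    ultimately show ?thesis using True e by simp
  next
    case False
    then have "z < - real M \<or> real M < z" by auto
    then show ?thesis
    proof
      assume "z < - real M"
      then show ?thesis using M0[of z] M False by (simp add: w_def)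
    next
      assume "real M < z"
      then show ?thesis using M1[of z] M False by (simp add: w_def)
    qed
  qed
  have bound: "\<bar>?d n\<bar> \<le> e / 2 + 2 * B * (occupation y {- real M..real M} n / real n)" if n: "0 < n" for n
  proof -
    have "(\<Sum>j<n. w (y j)) = occupation y {..0} n * \<phi> 0 + (real n - occupation y {..0} n) * \<phi> 1"
      by (simp add: w_def sum.distrib sum_distrib_right[symmetric] sum_subtractf occupation_def)
    then have "?d n = (1 / real n) * (\<Sum>j<n. \<phi> (logistic (y j)) - w (y j))"
      using n by (simp add: sum_subtractf low_fraction_def field_simps)
    then have "\<bar>?d n\<bar> = (1 / real n) * \<bar>\<Sum>j<n. \<phi> (logistic (y j)) - w (y j)\<bar>"
      by (simp add: abs_mult)
    also have "\<dots> \<le> (1 / real n) * (\<Sum>j<n. e / 2 + 2 * B * indicator {- real M..real M} (y j))"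
      by (intro mult_left_mono order_trans[OF sum_abs] sum_mono pointwise) auto
    also have "\<dots> = e / 2 + 2 * B * (occupation y {- real M..real M} n / real n)"
      using n unfolding sum.distrib sum_distrib_left[symmetric] occupation_def
      by (simp add: distrib_left)
    finally show ?thesis .
  qed
  have lim: "(\<lambda>n. 2 * B * (occupation y {- real M..real M} n / real n)) \<longlonglongrightarrow> 0"
    using y unfolding oscillating_def by (intro tendsto_mult_right_zero) blast
  then obtain no where no: "\<And>n. no \<le> n \<Longrightarrow> norm (2 * B * (occupation y {- real M..real M} n / real n) - 0) < e / 2"
    using LIMSEQ_D[OF lim half_gt_zero[OF e]] by blast
  show "\<exists>no. \<forall>n\<ge>no. norm (?d n - 0) < e"
  proof (intro exI[of _ "Suc no"] allI impI)
    fix n assume "Suc no \<le> n"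
    then show "norm (?d n - 0) < e"
      using bound[of n] no[of n] unfolding real_norm_def diff_zero by linarith
  qed
qed

lemma averages_diverge:
  assumes y: "oscillating y"
  shows "\<not> convergent (\<lambda>n. (1 / real n) * (\<Sum>j<n. logistic (y j)))"
proof
  assume "convergent (\<lambda>n. (1 / real n) * (\<Sum>j<n. logistic (y j)))"
  then obtain L where L: "(\<lambda>n. (1 / real n) * (\<Sum>j<n. logistic (y j))) \<longlonglongrightarrow> L"
    by (auto simp: convergent_def)
  have "(\<lambda>n. (1 / real n) * (\<Sum>j<n. logistic (y j)) - (low_fraction y n * 0 + (1 - low_fraction y n) * 1)) \<longlonglongrightarrow> 0"
    by (rule average_minus_mixture[OF y continuous_on_id[unfolded id_def]])
  from tendsto_diff[OF L this] have "(\<lambda>n. 1 - low_fraction y n) \<longlonglongrightarrow> L" by simp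
  then have "(\<lambda>n. 1 - (1 - low_fraction y n)) \<longlonglongrightarrow> 1 - L" by (intro tendsto_diff tendsto_const)
  then have lim: "low_fraction y \<longlonglongrightarrow> 1 - L" by simp
  obtain no where no: "\<And>n. no \<le> n \<Longrightarrow> \<bar>low_fraction y n - (1 - L)\<bar> < 1 / 4"
    using LIMSEQ_D[OF lim, of "1 / 4"] by auto
  obtain n where n: "n \<ge> no" "\<bar>low_fraction y n - 0\<bar> < 1 / 4"
    using low_fraction_approximates[OF y, of 0 "1/4" no] by auto
  obtain m where m: "m \<ge> no" "\<bar>low_fraction y m - 1\<bar> < 1 / 4"
    using low_fraction_approximates[OF y, of 1 "1/4" no] by auto
  show False using no[OF n(1)] no[OF m(1)] n(2) m(2) by linarith
qed

lemma measurable_into_borel_I: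
  "(\<And>i. y i \<in> {0..1}) \<Longrightarrow> y \<in> measure_pmf q \<rightarrow>\<^sub>M borel_I"
  unfolding borel_I_def by (intro measurable_restrict_space2) auto

lemma continuous_measurable_borel_I:
  "continuous_on {0..1} \<phi> \<Longrightarrow> \<phi> \<in> borel_measurable borel_I" for \<phi> :: "real \<Rightarrow> real"
  unfolding borel_I_def by (rule borel_measurable_continuous_on_restrict)

text \<open>Empirical measures and Dirac mixtures are images of discrete distributions, which makes their
  integrals finite sums.\<close>

lemma empirical_measure_eq_distr:
  assumes y: "\<And>j. y j \<in> {0..1}" and n: "0 < n"
  shows "empirical_measure y n = distr (measure_pmf (pmf_of_set {..<n})) borel_I y"
proof (rule measure_eqI)
  fix A assume "A \<in> sets (empirical_measure y n)"
  then have A: "A \<in> sets borel_I" by simp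
  have ne: "{..<n} \<noteq> {}" using n by auto
  have "emeasure (distr (measure_pmf (pmf_of_set {..<n})) borel_I y) A
    = (\<integral>\<^sup>+j. indicator A (y j) \<partial>measure_pmf (pmf_of_set {..<n}))"
    by (subst emeasure_distr[OF measurable_into_borel_I[OF y] A])
      (auto simp: indicator_def intro!: nn_integral_cong simp flip: nn_integral_indicator)
  also have "\<dots> = (\<Sum>j<n. indicator A (y j)) / (of_nat n :: ennreal)"
    using ne by (simp add: nn_integral_pmf_of_set)
  also have "\<dots> = (1 / of_nat n) * (\<Sum>j<n. indicator A (y j))"
    by (simp add: divide_ennreal_def mult.commute)
  also have "\<dots> = ennreal (1 / real n) * (\<Sum>j<n. indicator A (y j))"
    using n divide_ennreal[of 1 "real n"] by (simp add: ennreal_of_nat_eq_real_of_nat)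
  also have "\<dots> = emeasure (empirical_measure y n) A"
    using A by (simp add: emeasure_empirical_measure)
  finally show "emeasure (empirical_measure y n) A = emeasure (distr (measure_pmf (pmf_of_set {..<n})) borel_I y) A" ..
qed simp

lemma dirac_mixture_eq_distr:
  assumes t: "t \<in> {0..1}"
  shows "dirac_mixture t = distr (measure_pmf (bernoulli_pmf t)) borel_I (\<lambda>b. if b then 0 else 1)"
proof (rule measure_eqI)
  fix A assume "A \<in> sets (dirac_mixture t)"
  then have A: "A \<in> sets borel_I" by simp
  have m: "(\<lambda>b. if b then 0 else 1) \<in> measure_pmf (bernoulli_pmf t) \<rightarrow>\<^sub>M borel_I"
    by (rule measurable_into_borel_I) simp
  have "emeasure (distr (measure_pmf (bernoulli_pmf t)) borel_I (\<lambda>b. if b then 0 else 1)) A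
    = (\<integral>\<^sup>+b. indicator A (if b then 0 else 1) \<partial>measure_pmf (bernoulli_pmf t))"
    by (subst emeasure_distr[OF m A])
      (auto simp: indicator_def intro!: nn_integral_cong simp flip: nn_integral_indicator)
  also have "\<dots> = emeasure (dirac_mixture t) A"
    using A t by (simp add: emeasure_dirac_mixture mult.commute)
  finally show "emeasure (dirac_mixture t) A = emeasure (distr (measure_pmf (bernoulli_pmf t)) borel_I (\<lambda>b. if b then 0 else 1)) A" ..
qed simp

lemma integral_empirical_measure:
  fixes \<phi> :: "real \<Rightarrow> real"
  assumes "\<And>j. y j \<in> {0..1}" "0 < n" and \<phi>: "continuous_on {0..1} \<phi>"
  shows "(\<integral>x. \<phi> x \<partial>empirical_measure y n) = (1 / real n) * (\<Sum>j<n. \<phi> (y j))"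
  using assms lessThan_empty_iff[of n]
  by (simp add: empirical_measure_eq_distr integral_distr measurable_into_borel_I continuous_measurable_borel_I
      integral_pmf_of_set bot_nat_def)

lemma integral_dirac_mixture:
  fixes \<phi> :: "real \<Rightarrow> real"
  assumes t: "t \<in> {0..1}" and \<phi>: "continuous_on {0..1} \<phi>"
  shows "(\<integral>x. \<phi> x \<partial>dirac_mixture t) = t * \<phi> 0 + (1 - t) * \<phi> 1"
  using assms
  by (simp add: dirac_mixture_eq_distr integral_distr measurable_into_borel_I continuous_measurable_borel_I)

lemma empirical_measure_in_topspace:
  assumes "\<And>j. y j \<in> {0..1}" "0 < n"
  shows "empirical_measure y n \<in> topspace weak_star_topology"
  using assms unfolding topspace_weak_star_topology
  by (auto simp: empirical_measure_eq_distr intro!: measure_pmf.prob_space_distr measurable_into_borel_I)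

lemma dirac_mixture_in_topspace:
  assumes "t \<in> {0..1}"
  shows "dirac_mixture t \<in> topspace weak_star_topology"
  using assms unfolding topspace_weak_star_topology
  by (auto simp: dirac_mixture_eq_distr intro!: measure_pmf.prob_space_distr measurable_into_borel_I)

lemma openin_weak_star_integral:
  fixes \<phi> :: "real \<Rightarrow> real"
  assumes \<phi>: "continuous_on {0..1} \<phi>" and V: "open V"
  shows "openin weak_star_topology {\<mu> \<in> topspace weak_star_topology. (\<integral>x. \<phi> x \<partial>\<mu>) \<in> V}"
proof -
  let ?C = "{\<phi> :: real \<Rightarrow> real. continuous_on {0..1} \<phi>}"
  let ?T = "product_topology (\<lambda>_. euclideanreal) ?C"
  have "openin ?T {f \<in> topspace ?T. f \<phi> \<in> V}"
    using \<phi> V by (intro openin_continuous_map_preimage[OF continuous_map_product_projection]) auto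
  moreover have "{\<mu> \<in> topspace weak_star_topology. (\<integral>x. \<phi> x \<partial>\<mu>) \<in> V}
      = (\<lambda>\<mu>. \<lambda>\<phi>\<in>?C. \<integral>x. \<phi> x \<partial>\<mu>) -` {f \<in> topspace ?T. f \<phi> \<in> V} \<inter> space (prob_algebra borel_I)"
    using \<phi> by (auto simp: weak_star_topology_def topspace_pullback_topology)
  ultimately show ?thesis
    unfolding weak_star_topology_def openin_pullback_topology by blast
qed

text \<open>Testing with \<open>x * (1 - x)\<close>, which vanishes at both end points, shows that an
  accumulation point gives no mass to the open interval.\<close>

lemma accumulation_point_is_mixture:
  assumes y: "oscillating y"
    and \<mu>: "\<mu> \<in> weak_star_accumulation_points (empirical_measure (\<lambda>j. logistic (y j)))"
  shows "\<exists>t\<in>{0..1}. \<mu> = dirac_mixture t"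
proof -
  have I: "logistic (y j) \<in> {0..1}" for j using logistic_bounds[of "y j"] by auto
  have sets: "sets \<mu> = sets borel_I" and "prob_space \<mu>"
    using \<mu> by (auto simp: weak_star_accumulation_points_def topspace_weak_star_topology)
  interpret prob_space \<mu> by fact
  have space: "space \<mu> = {0..1}" using sets_eq_imp_space_eq[OF sets] by simp
  define \<phi> :: "real \<Rightarrow> real" where "\<phi> = (\<lambda>x. x * (1 - x))"
  have \<phi>: "continuous_on {0..1} \<phi>" unfolding \<phi>_def by (intro continuous_intros)
  have \<phi>m [measurable]: "\<phi> \<in> borel_measurable \<mu>"
    using continuous_measurable_borel_I[OF \<phi>] measurable_cong_sets[OF sets refl] by blast
  have \<phi>b: "0 \<le> \<phi> x" "\<phi> x \<le> 1" if "x \<in> {0..1}" for x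
    using that mult_le_one[of x "1 - x"] by (auto simp: \<phi>_def)
  have \<phi>i: "integrable \<mu> \<phi>"
    by (rule integrable_const_bound[where B=1]) (auto intro!: AE_I2 simp: space \<phi>b)
  have "\<bar>\<integral>x. \<phi> x \<partial>\<mu>\<bar> \<le> e" if e: "0 < e" for e
  proof -
    let ?c = "\<integral>x. \<phi> x \<partial>\<mu>"
    define U where "U = {\<nu> \<in> topspace weak_star_topology. (\<integral>x. \<phi> x \<partial>\<nu>) \<in> ball ?c (e / 2)}"
    have "openin weak_star_topology U" unfolding U_def by (rule openin_weak_star_integral[OF \<phi>]) simp
    moreover have "\<mu> \<in> U" using \<mu> e by (simp add: U_def weak_star_accumulation_points_def)
    ultimately have inf: "\<exists>\<^sub>\<infinity>n. empirical_measure (\<lambda>j. logistic (y j)) n \<in> U"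
      using \<mu> by (simp add: weak_star_accumulation_points_def)
    have lim: "(\<lambda>n. (1 / real n) * (\<Sum>j<n. \<phi> (logistic (y j)))) \<longlonglongrightarrow> 0"
      using average_minus_mixture[OF y \<phi>] by (simp add: \<phi>_def)
    then obtain no where no: "\<And>n. no \<le> n \<Longrightarrow> \<bar>(1 / real n) * (\<Sum>j<n. \<phi> (logistic (y j)))\<bar> < e / 2"
      using LIMSEQ_D[OF lim half_gt_zero[OF e]] unfolding real_norm_def diff_zero by blast
    obtain n where n: "n \<ge> Suc no" "empirical_measure (\<lambda>j. logistic (y j)) n \<in> U"
      using inf by (auto simp: INFM_nat_le)
    have "dist ?c ((1 / real n) * (\<Sum>j<n. \<phi> (logistic (y j)))) < e / 2"
      using n integral_empirical_measure[of "\<lambda>j. logistic (y j)" n \<phi>, OF I _ \<phi>] by (simp add: U_def)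
    then show ?thesis using no[of n] n(1) unfolding dist_real_def by linarith
  qed
  then have "\<bar>\<integral>x. \<phi> x \<partial>\<mu>\<bar> \<le> 0" by (rule field_le_epsilon[of _ 0, simplified])
  then have "(\<integral>x. \<phi> x \<partial>\<mu>) = 0" by simp
  moreover have "AE x in \<mu>. 0 \<le> \<phi> x" by (intro AE_I2 \<phi>b) (simp add: space)
  ultimately have "AE x in \<mu>. \<phi> x = 0"
    using integral_nonneg_eq_0_iff_AE[OF \<phi>i] by blast
  then have ends: "AE x in \<mu>. x = 0 \<or> x = 1" by eventually_elim (simp add: \<phi>_def)
  have s01: "{0} \<in> sets \<mu>" "{1} \<in> sets \<mu>"
    by (auto simp: sets borel_I_def sets_restrict_space intro!: image_eqI[where x="{_}"])
  define t where "t = measure \<mu> {0}"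
  have t: "t \<in> {0..1}" by (simp add: t_def)
  have "measure \<mu> {0} + measure \<mu> {1} = measure \<mu> {0, 1}"
    using s01 finite_measure_Union[of "{0}" "{1}"] by (simp add: insert_commute)
  also have "\<dots> = 1"
  proof (rule prob_eq_1[THEN iffD2])
    show "{0, 1} \<in> sets \<mu>" using sets.Un[OF s01] by (simp add: insert_commute)
  qed (use ends in simp)
  finally have t1: "measure \<mu> {1} = 1 - t" by (simp add: t_def)
  have "\<mu> = dirac_mixture t"
  proof (rule measure_eqI)
    show "sets \<mu> = sets (dirac_mixture t)" by (simp add: sets)
    fix A assume A: "A \<in> sets \<mu>"
    have "emeasure \<mu> A = (\<integral>\<^sup>+x. indicator A x \<partial>\<mu>)" using A by simp
    also have "\<dots> = (\<integral>\<^sup>+x. indicator A 0 * indicator {0} x + indicator A 1 * indicator {1} x \<partial>\<mu>)"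
      using ends by (intro nn_integral_cong_AE) (auto elim!: eventually_mono simp: indicator_def)
    also have "\<dots> = indicator A 0 * ennreal t + indicator A 1 * ennreal (1 - t)"
      using s01 t1 by (simp add: nn_integral_add nn_integral_cmult emeasure_eq_measure t_def)
    also have "\<dots> = emeasure (dirac_mixture t) A"
      using A by (simp add: emeasure_dirac_mixture sets mult.commute)
    finally show "emeasure \<mu> A = emeasure (dirac_mixture t) A" .
  qed
  then show ?thesis using t by blast
qed

lemma mixture_is_accumulation_point:
  assumes y: "oscillating y" and t: "t \<in> {0..1}"
  shows "dirac_mixture t \<in> weak_star_accumulation_points (empirical_measure (\<lambda>j. logistic (y j)))"
proof -
  let ?M = "empirical_measure (\<lambda>j. logistic (y j))"
  have I: "logistic (y j) \<in> {0..1}" for j using logistic_bounds[of "y j"] by auto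
  have "\<exists>\<^sub>\<infinity>n. ?M n \<in> U" if U: "openin weak_star_topology U" "dirac_mixture t \<in> U" for U
    unfolding INFM_nat_le
  proof
    fix m :: nat
    have "\<forall>k. \<exists>n\<ge>m + k. 0 < n \<and> \<bar>low_fraction y n - t\<bar> < inverse (real (Suc k))"
      using t by (intro allI low_fraction_approximates[OF y]) auto
    then obtain r where r: "\<And>k. m + k \<le> r k" "\<And>k. 0 < r k"
      and rt: "\<And>k. \<bar>low_fraction y (r k) - t\<bar> < inverse (real (Suc k))" by metis
    have "filterlim r at_top sequentially"
      by (rule filterlim_at_top_mono[OF filterlim_ident]) (use r(1) in \<open>auto intro!: always_eventually order_trans[OF _ r(1)]\<close>)
    moreover have low: "(\<lambda>k. low_fraction y (r k)) \<longlonglongrightarrow> t"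
      by (rule LIM_zero_cancel, rule Lim_null_comparison[OF _ LIMSEQ_inverse_real_of_nat])
         (use rt in \<open>auto intro!: always_eventually less_imp_le\<close>)
    ultimately have "limitin weak_star_topology (\<lambda>k. ?M (r k)) (dirac_mixture t) sequentially"
    proof (subst limitin_weak_star_topology, goal_cases)
      case 3
      show ?case
      proof (intro allI impI)
        fix \<phi> :: "real \<Rightarrow> real" assume \<phi>: "continuous_on {0..1} \<phi>"
        let ?d = "\<lambda>n. (1 / real n) * (\<Sum>j<n. \<phi> (logistic (y j)))
          - (low_fraction y n * \<phi> 0 + (1 - low_fraction y n) * \<phi> 1)"
        have "(\<lambda>k. ?d (r k)) \<longlonglongrightarrow> 0"
          using filterlim_compose[OF average_minus_mixture[OF y \<phi>] 3(1)] .
        then have "(\<lambda>k. ?d (r k) + (low_fraction y (r k) * \<phi> 0 + (1 - low_fraction y (r k)) * \<phi> 1))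
            \<longlonglongrightarrow> 0 + (t * \<phi> 0 + (1 - t) * \<phi> 1)"
          by (intro tendsto_intros 3(2))
        then show "(\<lambda>k. \<integral>x. \<phi> x \<partial>?M (r k)) \<longlonglongrightarrow> (\<integral>x. \<phi> x \<partial>dirac_mixture t)"
          using integral_empirical_measure[of "\<lambda>j. logistic (y j)", OF I r(2) \<phi>] integral_dirac_mixture[OF t \<phi>]
          by simp
      qed
    qed (auto intro: empirical_measure_in_topspace[OF I] r dirac_mixture_in_topspace[OF t])
    then have "\<forall>\<^sub>F k in sequentially. ?M (r k) \<in> U" using U unfolding limitin_def by blast
    then obtain k where "?M (r k) \<in> U" using eventually_happens by fastforce
    then show "\<exists>n\<ge>m. ?M n \<in> U" using r(1)[of k] by (intro exI[of _ "r k"]) auto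
  qed
  then show ?thesis
    using dirac_mixture_in_topspace[OF t] by (auto simp: weak_star_accumulation_points_def)
qed

section \<open>Martingale-coboundary decomposition\<close>

text \<open>Gordin's martingale-coboundary decomposition. The transfer operator contracts exponentially to the
  mean: \<open>transfer p n \<phi>\<close> forgets the difference between two points up to
  \<open>C * \<theta> ^ n\<close>, and its mean is zero. So the series \<open>u = transfer p 1
  \<phi> + transfer p 2 \<phi> + \<dots>\<close> converges uniformly, and it satisfies
  \<open>transfer p 1 u = u - transfer p 1 \<phi>\<close>. Since \<open>transfer p 1 (u \<circ>
  left_shift) = u\<close>, the transfer operator annihilates \<open>\<psi> = \<phi> + u - u
  \<circ> left_shift\<close>.\<close>

lemma gordin_decomposition:
  fixes p :: "'a::finite pmf"
  assumes \<phi>: "cylinder_lipschitz C \<theta> \<phi>" and \<theta>: "0 < \<theta>" "\<theta> < 1"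
    and mean: "(\<integral>\<omega>. \<phi> \<omega> \<partial>bernoulli p) = 0"
  obtains C' \<psi> u where "cylinder_lipschitz C' \<theta> \<psi>" "\<And>\<omega>. transfer p 1 \<psi> \<omega> = 0"
    "u \<in> borel_measurable (bernoulli p)" "\<And>\<omega>. \<bar>u \<omega>\<bar> \<le> C / (1 - \<theta>)"
    "\<And>\<omega>. \<phi> \<omega> = \<psi> \<omega> + u (left_shift \<omega>) - u \<omega>"
proof -
  let ?P = "bernoulli p"
  define L where "L = (\<lambda>n. transfer p n \<phi>)"
  have C: "0 \<le> C" using \<phi> by (rule cylinder_lipschitz_nonneg)
  have [measurable]: "\<phi> \<in> borel_measurable ?P" using \<phi> \<theta> by (rule cylinder_lipschitz_measurable)
  have Lm [measurable]: "L n \<in> borel_measurable ?P" for n unfolding L_def by measurable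
  have \<phi>b: "\<bar>\<phi> \<omega>\<bar> \<le> \<bar>\<phi> undefined\<bar> + C" for \<omega>
    using cylinder_lipschitz_osc[OF \<phi>, of \<omega> undefined] by linarith
  have L_diff: "\<bar>L n \<omega> - L n \<omega>'\<bar> \<le> C * \<theta> ^ (n + k)" if "\<And>i. i < k \<Longrightarrow> \<omega> i = \<omega>' i" for n k \<omega> \<omega>'
  proof -
    have i: "integrable ?P (\<lambda>\<omega>1. \<phi> (comb_seq n \<omega>1 \<omega>))" for \<omega>
      by (rule integrable_bounded[OF _ \<phi>b]) measurable
    have "\<bar>\<phi> (comb_seq n \<omega>1 \<omega>) - \<phi> (comb_seq n \<omega>1 \<omega>')\<bar> \<le> C * \<theta> ^ (n + k)" for \<omega>1
    proof (rule cylinder_lipschitzD[OF \<phi>])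
      fix i assume "i < n + k"
      then show "comb_seq n \<omega>1 \<omega> i = comb_seq n \<omega>1 \<omega>' i"
        using that[of "i - n"] by (cases "i < n") (simp_all add: comb_seq_def)
    qed
    then have "\<bar>\<integral>\<omega>1. \<phi> (comb_seq n \<omega>1 \<omega>) - \<phi> (comb_seq n \<omega>1 \<omega>') \<partial>?P\<bar> \<le> C * \<theta> ^ (n + k)"
      by (rule abs_integral_le)
    then show ?thesis
      unfolding L_def transfer_def by (subst (asm) Bochner_Integration.integral_diff[OF i i])
  qed
  have Lb: "\<bar>L n \<omega>\<bar> \<le> C * \<theta> ^ n" for n \<omega>
  proof -
    have b: "\<bar>L n \<omega>'\<bar> \<le> \<bar>\<phi> undefined\<bar> + C" for \<omega>' unfolding L_def by (rule transfer_bounded[OF \<phi>b])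
    have "(\<integral>\<omega>'. L n \<omega>' \<partial>?P) = 0"
      unfolding L_def transfer_def
      by (rule integral_split[OF _ \<phi>b, symmetric, THEN trans]) (measurable, rule mean)
    then have "L n \<omega> = (\<integral>\<omega>'. L n \<omega> - L n \<omega>' \<partial>?P)"
      using integrable_bounded[OF Lm b] by (subst Bochner_Integration.integral_diff) auto
    moreover have "\<bar>\<integral>\<omega>'. L n \<omega> - L n \<omega>' \<partial>?P\<bar> \<le> C * \<theta> ^ n"
      using L_diff[where k=0] by (intro abs_integral_le) simp
    ultimately show ?thesis by simp
  qed
  have geo: "(\<lambda>n. C * \<theta> ^ n) sums (C / (1 - \<theta>))"
    using sums_mult[OF geometric_sums[of \<theta>], of C] \<theta> by simp
  have geo1: "(\<lambda>n. C * \<theta> ^ Suc n) sums (\<theta> * (C / (1 - \<theta>)))"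
    using sums_mult[OF geo, of \<theta>] by (simp add: ac_simps)
  have geo1_le: "\<theta> * (C / (1 - \<theta>)) \<le> C / (1 - \<theta>)"
    using \<theta> C by (intro mult_left_le_one_le) auto
  define u where "u = (\<lambda>\<omega>. \<Sum>n. L (Suc n) \<omega>)"
  have sum_abs: "summable (\<lambda>n. \<bar>L (Suc n) \<omega>\<bar>)" for \<omega>
    by (rule summable_comparison_test'[OF sums_summable[OF geo1], of 0]) (simp only: real_norm_def abs_abs Lb)
  have sum: "summable (\<lambda>n. L (Suc n) \<omega>)" for \<omega>
    by (rule summable_rabs_cancel[OF sum_abs])
  have um [measurable]: "u \<in> borel_measurable ?P" unfolding u_def by measurable
  have ub: "\<bar>u \<omega>\<bar> \<le> C / (1 - \<theta>)" for \<omega>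
  proof -
    have "\<bar>u \<omega>\<bar> \<le> (\<Sum>n. \<bar>L (Suc n) \<omega>\<bar>)" unfolding u_def by (rule summable_rabs[OF sum_abs])
    also have "\<dots> \<le> (\<Sum>n. C * \<theta> ^ Suc n)"
      by (intro suminf_le Lb sum_abs sums_summable[OF geo1])
    also have "\<dots> = \<theta> * (C / (1 - \<theta>))" using geo1 by (rule sums_unique[symmetric])
    finally show ?thesis using geo1_le by linarith
  qed
  have u_lip: "\<bar>u \<omega> - u \<omega>'\<bar> \<le> C / (1 - \<theta>) * \<theta> ^ Suc k" if eq: "\<And>i. i < k \<Longrightarrow> \<omega> i = \<omega>' i" for k \<omega> \<omega>'
  proof -
    have le: "\<bar>L (Suc n) \<omega> - L (Suc n) \<omega>'\<bar> \<le> C * \<theta> ^ Suc n * \<theta> ^ k" for n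
      using L_diff[of k \<omega> \<omega>' "Suc n", OF eq] by (simp add: power_add)
    have g: "(\<lambda>n. C * \<theta> ^ Suc n * \<theta> ^ k) sums (\<theta> * (C / (1 - \<theta>)) * \<theta> ^ k)"
      by (rule sums_mult2[OF geo1])
    have s: "summable (\<lambda>n. \<bar>L (Suc n) \<omega> - L (Suc n) \<omega>'\<bar>)"
      by (rule summable_comparison_test'[OF sums_summable[OF g], of 0]) (simp only: real_norm_def abs_abs le)
    have "\<bar>u \<omega> - u \<omega>'\<bar> = \<bar>\<Sum>n. L (Suc n) \<omega> - L (Suc n) \<omega>'\<bar>"
      unfolding u_def by (simp add: suminf_diff[OF sum sum])
    also have "\<dots> \<le> (\<Sum>n. \<bar>L (Suc n) \<omega> - L (Suc n) \<omega>'\<bar>)" by (rule summable_rabs[OF s])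
    also have "\<dots> \<le> (\<Sum>n. C * \<theta> ^ Suc n * \<theta> ^ k)" by (intro suminf_le le s sums_summable[OF g])
    also have "\<dots> = \<theta> * (C / (1 - \<theta>)) * \<theta> ^ k" using g by (rule sums_unique[symmetric])
    finally show ?thesis by (simp add: mult_ac)
  qed
  define K where "K = C / (1 - \<theta>)"
  have K: "0 \<le> K" using C \<theta> by (simp add: K_def)
  define \<psi> where "\<psi> = (\<lambda>\<omega>. \<phi> \<omega> + u \<omega> - u (left_shift \<omega>))"
  have \<psi>: "cylinder_lipschitz (C + 2 * K) \<theta> \<psi>"
    unfolding cylinder_lipschitz_def
  proof (intro allI impI)
    fix n and \<omega> \<omega>' :: "nat \<Rightarrow> 'a" assume eq: "\<forall>i<n. \<omega> i = \<omega>' i"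
    have "\<bar>\<phi> \<omega> - \<phi> \<omega>'\<bar> \<le> C * \<theta> ^ n" using eq by (intro cylinder_lipschitzD[OF \<phi>]) auto
    moreover have "\<bar>u \<omega> - u \<omega>'\<bar> \<le> K * \<theta> ^ n"
    proof -
      have "\<bar>u \<omega> - u \<omega>'\<bar> \<le> K * \<theta> ^ Suc n" unfolding K_def using eq by (intro u_lip) auto
      also have "\<dots> \<le> K * \<theta> ^ n" using K \<theta> by (intro mult_left_mono power_decreasing) auto
      finally show ?thesis .
    qed
    moreover have "\<bar>u (left_shift \<omega>) - u (left_shift \<omega>')\<bar> \<le> K * \<theta> ^ n"
    proof -
      \<comment> \<open>The shift loses one coordinate, which the extra factor \<open>\<theta>\<close> in
        \<open>u_lip\<close> pays for; for \<open>n = 0\<close> the exponent is \<open>1\<close>,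
        which only improves the bound.\<close>
      have "\<bar>u (left_shift \<omega>) - u (left_shift \<omega>')\<bar> \<le> K * \<theta> ^ Suc (n - 1)"
        unfolding K_def using eq by (intro u_lip) (auto simp: left_shift_def)
      also have "\<dots> \<le> K * \<theta> ^ n" using K \<theta> by (intro mult_left_mono power_decreasing) auto
      finally show ?thesis .
    qed
    ultimately show "\<bar>\<psi> \<omega> - \<psi> \<omega>'\<bar> \<le> (C + 2 * K) * \<theta> ^ n"
      unfolding \<psi>_def by (simp add: algebra_simps)
  qed
  have zero: "transfer p 1 \<psi> \<omega> = 0" for \<omega>
  proof -
    have i: "integrable ?P (\<lambda>\<omega>1. L n (comb_seq 1 \<omega>1 \<omega>))" for n
      by (rule integrable_bounded[OF _ Lb]) measurable
    have "transfer p 1 u \<omega> = (\<Sum>n. \<integral>\<omega>1. L (Suc n) (comb_seq 1 \<omega>1 \<omega>) \<partial>?P)"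
      unfolding transfer_def u_def
    proof (rule integral_suminf)
      show "AE \<omega>1 in ?P. summable (\<lambda>n. norm (L (Suc n) (comb_seq 1 \<omega>1 \<omega>)))"
        using sum_abs by (simp del: comb_seq_Suc_0 One_nat_def)
      show "summable (\<lambda>n. \<integral>\<omega>1. norm (L (Suc n) (comb_seq 1 \<omega>1 \<omega>)) \<partial>?P)"
      proof (rule summable_comparison_test'[OF sums_summable[OF geo1], of 0])
        fix n
        show "norm (\<integral>\<omega>1. norm (L (Suc n) (comb_seq 1 \<omega>1 \<omega>)) \<partial>?P) \<le> C * \<theta> ^ Suc n"
          unfolding real_norm_def by (rule abs_integral_le) (simp only: abs_abs Lb)
      qed
    qed (rule i)
    also have "(\<lambda>n. \<integral>\<omega>1. L (Suc n) (comb_seq 1 \<omega>1 \<omega>) \<partial>?P) = (\<lambda>n. L (Suc (Suc n)) \<omega>)"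
    proof
      fix n
      have "transfer p 1 (L (Suc n)) \<omega> = L (Suc n + 1) \<omega>"
        unfolding L_def by (subst transfer_transfer[OF _ \<phi>b]) auto
      then show "(\<integral>\<omega>1. L (Suc n) (comb_seq 1 \<omega>1 \<omega>) \<partial>?P) = L (Suc (Suc n)) \<omega>"
        unfolding transfer_def[of p 1 "L (Suc n)" \<omega>] by simp
    qed
    also have "(\<Sum>n. L (Suc (Suc n)) \<omega>) = u \<omega> - L 1 \<omega>"
      unfolding u_def using suminf_split_head[OF sum, of \<omega>] by simp
    finally have tu: "transfer p 1 u \<omega> = u \<omega> - L 1 \<omega>" .
    have ts: "transfer p 1 (\<lambda>\<omega>. u (left_shift \<omega>)) \<omega> = u \<omega>"
      using transfer_shift[of p 1 u] by (simp add: fun_eq_iff)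
    have "transfer p 1 \<psi> \<omega> = transfer p 1 \<phi> \<omega> + transfer p 1 u \<omega> - transfer p 1 (\<lambda>\<omega>. u (left_shift \<omega>)) \<omega>"
    proof -
      have "integrable ?P (\<lambda>\<omega>1. \<phi> (comb_seq 1 \<omega>1 \<omega>))" by (rule integrable_bounded[OF _ \<phi>b]) measurable
      moreover have "integrable ?P (\<lambda>\<omega>1. u (comb_seq 1 \<omega>1 \<omega>))" by (rule integrable_bounded[OF _ ub]) measurable
      moreover have "integrable ?P (\<lambda>\<omega>1. u (left_shift (comb_seq 1 \<omega>1 \<omega>)))" by (rule integrable_bounded[OF _ ub]) measurable
      ultimately show ?thesis
        unfolding transfer_def \<psi>_def by (simp del: comb_seq_Suc_0 One_nat_def)
    qed
    then show ?thesis unfolding tu ts by (simp add: L_def)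
  qed
  show thesis
    by (rule that[OF \<psi> zero um ub]) (simp add: \<psi>_def)
qed

lemma birkhoff_coboundary:
  assumes "\<And>\<omega>. \<phi> \<omega> = \<psi> \<omega> + u (left_shift \<omega>) - u \<omega>"
  shows "birkhoff \<phi> n \<omega> = birkhoff \<psi> n \<omega> + u ((left_shift ^^ n) \<omega>) - u \<omega>"
  by (induction n) (simp_all add: birkhoff_def assms)

lemma birkhoff_uminus: "birkhoff (\<lambda>\<omega>. - \<psi> \<omega>) n \<omega> = - birkhoff \<psi> n \<omega>"
  by (simp add: birkhoff_def sum_negf)

text \<open>The hypotheses are symmetric under \<open>\<psi> \<mapsto> -\<psi>\<close>, which turns the
  statement on high excursions into the one on low excursions.\<close>

lemma (in reverse_martingale) AE_oscillating: "AE \<omega> in P. oscillating (\<lambda>n. S n \<omega>)"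
proof -
  interpret neg: reverse_martingale p "\<lambda>\<omega>. - \<psi> \<omega>" C \<theta>
  proof
    show "cylinder_lipschitz C \<theta> (\<lambda>\<omega>. - \<psi> \<omega>)"
      using lip by (simp add: cylinder_lipschitz_def abs_minus_commute)
    show "transfer p 1 (\<lambda>\<omega>. - \<psi> \<omega>) \<omega> = 0" for \<omega>
      using zero[of \<omega>] by (simp add: transfer_def)
  qed (use theta nontriv in auto)
  have eq: "occupation (\<lambda>j. birkhoff (\<lambda>\<omega>. - \<psi> \<omega>) j \<omega>) {r<..} n = occupation (\<lambda>j. S j \<omega>) {..<- r} n" for r n \<omega>
    unfolding occupation_def birkhoff_uminus by (intro sum.cong) (auto simp: indicator_def)
  show ?thesis
    using neg.AE_high_fraction AE_high_fraction AE_bounded_density_zero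
    by eventually_elim (simp only: oscillating_def eq simp_thms)
qed

text \<open>The Gordin decomposition replaces the sums of \<open>\<phi>\<close> by those of a reverse
  martingale up to a bounded error. If the increments of the latter had variance zero, the
  decomposition would exhibit \<open>\<phi>\<close> as a coboundary of a bounded function.\<close>

lemma AE_birkhoff_oscillating:
  fixes p :: "'a::finite pmf"
  assumes \<phi>: "hoelder_continuous \<phi>" and mean: "(\<integral>\<omega>. \<phi> \<omega> \<partial>bernoulli p) = 0"
    and cob: "\<not> L2_coboundary (bernoulli p) \<phi>"
  shows "AE \<omega> in bernoulli p. oscillating (\<lambda>n. birkhoff \<phi> n \<omega>)"
proof -
  obtain C \<theta> where C: "cylinder_lipschitz C \<theta> \<phi>" and \<theta>: "0 < \<theta>" "\<theta> < 1"
    using hoelder_cylinder_lipschitz[OF \<phi>] .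
  obtain C' \<psi> u where lip: "cylinder_lipschitz C' \<theta> \<psi>" and zero: "\<And>\<omega>. transfer p 1 \<psi> \<omega> = 0"
    and u: "u \<in> borel_measurable (bernoulli p)" and ub: "\<And>\<omega>. \<bar>u \<omega>\<bar> \<le> C / (1 - \<theta>)"
    and dec: "\<And>\<omega>. \<phi> \<omega> = \<psi> \<omega> + u (left_shift \<omega>) - u \<omega>"
    by (rule gordin_decomposition[OF C \<theta> mean]) (rule that)
  note [measurable] = u
  have [measurable]: "\<psi> \<in> borel_measurable (bernoulli p)"
    using lip \<theta> by (rule cylinder_lipschitz_measurable)
  have "0 < (\<integral>\<omega>. (\<psi> \<omega>)\<^sup>2 \<partial>bernoulli p)"
  proof (rule ccontr)
    assume n: "\<not> ?thesis"
    have b: "\<bar>\<psi> \<omega>\<bar> \<le> \<bar>\<psi> undefined\<bar> + C'" for \<omega>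
      using cylinder_lipschitz_osc[OF lip, of \<omega> undefined] by linarith
    have "integrable (bernoulli p) (\<lambda>\<omega>. (\<psi> \<omega>)\<^sup>2)"
      by (rule integrable_bounded[where K="(\<bar>\<psi> undefined\<bar> + C')\<^sup>2"])
        (use b cylinder_lipschitz_nonneg[OF lip] in \<open>auto simp flip: abs_le_square_iff\<close>)
    moreover have "(\<integral>\<omega>. (\<psi> \<omega>)\<^sup>2 \<partial>bernoulli p) = 0"
      using n by (intro antisym Bochner_Integration.integral_nonneg) auto
    ultimately have "AE \<omega> in bernoulli p. (\<psi> \<omega>)\<^sup>2 = 0"
      by (subst (asm) integral_nonneg_eq_0_iff_AE) auto
    then have "AE \<omega> in bernoulli p. \<phi> \<omega> = u (left_shift \<omega>) - u \<omega>"
      by eventually_elim (simp add: dec)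
    moreover have "integrable (bernoulli p) (\<lambda>\<omega>. (u \<omega>)\<^sup>2)"
      by (rule integrable_bounded[where K="(C / (1 - \<theta>))\<^sup>2"])
        (use ub cylinder_lipschitz_nonneg[OF C] \<theta> in \<open>auto simp flip: abs_le_square_iff simp del: power_divide\<close>)
    ultimately have "L2_coboundary (bernoulli p) \<phi>"
      unfolding L2_coboundary_def using u by blast
    then show False using cob by contradiction
  qed
  then interpret reverse_martingale p \<psi> C' \<theta>
    by unfold_locales (rule lip \<theta> zero | assumption)+
  show ?thesis
    using AE_oscillating
  proof eventually_elim
    case (elim \<omega>)
    have "\<bar>birkhoff \<phi> j \<omega> - S j \<omega>\<bar> \<le> 2 * (C / (1 - \<theta>))" for j
      unfolding birkhoff_coboundary[of \<phi> \<psi> u, OF dec]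
      using ub[of \<omega>] ub[of "(left_shift ^^ j) \<omega>"] by linarith
    then show ?case by (rule oscillating_perturb[OF elim])
  qed
qed

section \<open>The skew product\<close>

text \<open>The logistic function conjugates the fibre map to a translation of the line: with odds \<open>x /
  (1 - x) = exp z\<close>, one step multiplies the odds by \<open>a \<omega>\<close>.\<close>

lemma fibre_iterate_F_skew:
  assumes a: "\<And>\<omega>. a \<omega> > 0"
  shows "fibre_iterate (F_skew a) n \<omega> (logistic z) = logistic (z + birkhoff (\<lambda>\<omega>. ln (a \<omega>)) n \<omega>)"
proof (induction n)
  case 0
  then show ?case by simp
next
  case (Suc n)
  have step: "b * logistic w / (1 + (b - 1) * logistic w) = logistic (w + ln b)" if "b > 0" for b w
  proof -
    have p: "0 < 1 + exp w" "0 < 1 + b * exp w" using that by (auto simp: add_pos_pos)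
    have "1 + (b - 1) * logistic w = (1 + b * exp w) / (1 + exp w)"
      using p by (simp add: logistic_def field_simps)
    then show ?thesis using p that by (simp add: logistic_def exp_add mult.commute)
  qed
  have "fibre_map (F_skew a) = (\<lambda>\<omega> x. a \<omega> * x / (1 + (a \<omega> - 1) * x))"
    by (simp add: F_skew_def)
  then show ?case by (simp add: Suc step[OF a] birkhoff_def add.assoc)
qed

lemma logistic_logit:
  assumes "0 < x" "x < 1"
  shows "logistic (ln (x / (1 - x))) = x"
  using assms by (simp add: logistic_def field_simps)

text \<open>The end points are fixed by all fibre maps and have to be discarded.\<close>

lemma AE_pair_borel_I:
  assumes "AE \<omega> in bernoulli p. Q \<omega>"
  shows "AE (\<omega>, x) in bernoulli p \<Otimes>\<^sub>M Leb_I. Q \<omega> \<and> 0 < x \<and> x < 1"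
proof -
  let ?P = "bernoulli p"
  have sp: "space Leb_I = {0..1}" by (simp add: Leb_I_def space_restrict_space)
  have em: "emeasure Leb_I A = emeasure lborel A" if "A \<in> sets borel" "A \<subseteq> {0..1}" for A
    using that unfolding Leb_I_def by (intro emeasure_restrict_space) auto
  interpret L: finite_measure Leb_I
    by (rule finite_measureI) (simp add: sp em)
  obtain N where N: "N \<in> null_sets ?P" "{\<omega>\<in>space ?P. \<not> Q \<omega>} \<subseteq> N"
    using assms by (auto elim!: AE_E simp: null_sets_def)
  have ends: "{0, 1} \<in> null_sets Leb_I"
  proof
    show "{0, 1} \<in> sets Leb_I" by (auto simp: Leb_I_def sets_restrict_space_iff)
    have "{0::real, 1} \<in> null_sets lborel" by (intro finite_imp_null_set_lborel) simp
    then show "emeasure Leb_I {0, 1} = 0" by (subst em) (auto simp: null_sets_def)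
  qed
  show ?thesis
  proof (rule AE_I')
    show "N \<times> space Leb_I \<union> space ?P \<times> {0, 1} \<in> null_sets (?P \<Otimes>\<^sub>M Leb_I)"
      using N(1) ends by (intro null_sets.Un) (auto simp: null_sets_def L.emeasure_pair_measure_Times simp del: space_bernoulli)
    show "{z \<in> space (?P \<Otimes>\<^sub>M Leb_I). \<not> (case z of (\<omega>, x) \<Rightarrow> Q \<omega> \<and> 0 < x \<and> x < 1)}
        \<subseteq> N \<times> space Leb_I \<union> space ?P \<times> {0, 1}"
      using N(2) by (auto simp: space_pair_measure sp)
  qed
qed

theorem corollary10:
  fixes p :: "'a::finite pmf" and a :: "(nat \<Rightarrow> 'a) \<Rightarrow> real"
  assumes "set_pmf p = UNIV"
    and "\<And>\<omega>. a \<omega> > 0"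
    and "hoelder_continuous (\<lambda>\<omega>. ln (a \<omega>))"
    and "(\<integral>\<omega>. ln (a \<omega>) \<partial>bernoulli p) = 0"
    and "\<And>\<omega>. a \<omega> \<noteq> 1"
    and "\<not> L2_coboundary (bernoulli p) (\<lambda>\<omega>. ln (a \<omega>))"
  shows "historical_behavior (bernoulli p) (F_skew a) \<and>
    (AE (\<omega>, x) in bernoulli p \<Otimes>\<^sub>M Leb_I.
       limit_measures (F_skew a) \<omega> x = {dirac_mixture t | t. t \<in> {0..1}})"
proof -
  let ?\<phi> = "\<lambda>\<omega>. ln (a \<omega>)"
  have good: "AE (\<omega>, x) in bernoulli p \<Otimes>\<^sub>M Leb_I. oscillating (\<lambda>n. birkhoff ?\<phi> n \<omega>) \<and> 0 < x \<and> x < 1"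
    by (intro AE_pair_borel_I AE_birkhoff_oscillating assms)
  have orbit: "\<exists>y. oscillating y \<and> (\<forall>j. fibre_iterate (F_skew a) j \<omega> x = logistic (y j))"
    if "oscillating (\<lambda>n. birkhoff ?\<phi> n \<omega>)" "0 < x" "x < 1" for \<omega> x
  proof (intro exI conjI allI)
    let ?z = "ln (x / (1 - x))"
    show "oscillating (\<lambda>n. ?z + birkhoff ?\<phi> n \<omega>)"
      by (rule oscillating_perturb[OF that(1), where K="\<bar>?z\<bar>"]) simp
    show "fibre_iterate (F_skew a) j \<omega> x = logistic (?z + birkhoff ?\<phi> j \<omega>)" for j
      using fibre_iterate_F_skew[of a j \<omega> ?z, OF assms(2)] that by (simp add: logistic_logit)
  qed
  have "historical_behavior (bernoulli p) (F_skew a)"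
    unfolding historical_behavior_def using good
  proof eventually_elim
    case (elim z)
    obtain \<omega> x where z: "z = (\<omega>, x)" by (cases z)
    obtain y where y: "oscillating y" "\<And>j. fibre_iterate (F_skew a) j \<omega> x = logistic (y j)"
      using orbit[of \<omega> x] elim z by auto
    show ?case unfolding z prod.case y(2)
      using averages_diverge[OF y(1)] by (intro exI[of _ "\<lambda>x. x"]) (auto intro: continuous_intros)
  qed
  moreover have "AE (\<omega>, x) in bernoulli p \<Otimes>\<^sub>M Leb_I.
       limit_measures (F_skew a) \<omega> x = {dirac_mixture t | t. t \<in> {0..1}}"
    using good
  proof eventually_elim
    case (elim z)
    obtain \<omega> x where z: "z = (\<omega>, x)" by (cases z)
    obtain y where y: "oscillating y" "\<And>j. fibre_iterate (F_skew a) j \<omega> x = logistic (y j)"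
      using orbit[of \<omega> x] elim z by auto
    show ?case unfolding z prod.case limit_measures_def y(2)
      using accumulation_point_is_mixture[OF y(1)] mixture_is_accumulation_point[OF y(1)] by blast
  qed
  ultimately show ?thesis ..
qed

end
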